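(* Let $D\subset\mathbb{R}^d$ be an admissible, bounded, $C^1$ domain with inward unit normal field $n$ on $\partial D$, such that locally on $\partial D$ the following holds: every point of $\partial D$ has a neighborhood $U$ and an $\varepsilon>0$ with $$\sup_{x,y\in\partial D\cap U,\ |x-y|=r}|n(x)-n(y)|<r/\varepsilon\qquad\text{for all } r>0 .$$ Then for every continuous $w:[0,\infty)\to\mathbb{R}^d$ with $w_0\in D$ there exists a solution to the extended Skorohod problem for $(w,D,n)$, that is, a continuous $x:[0,\infty)\to\bar D$ and a continuous $L:[0,\infty)\to\mathbb{R}^d$ of bounded variation on every $(0,T)$, $T<\infty$, with $|L|_t=\int_0^t1_{(x_s\in\partial D)}\,d|L|_s$, $L_t=\int_0^tn(x_s)\,d|L|_s$, and $$x_t=w_t+\int_0^tL_s\,ds+L_t,\qquad t\ge0,$$ where $|L|_t$ is the total variation of $L$ on $[0,t]$.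
   Context: $d\ge2$; the supremum over an empty set is $0$; $(\cdot,\cdot)$ is the Euclidean inner product. A domain $D$ is admissible if there is a sequence $\{D_m\}$ of bounded smooth open sets in $\mathbb{R}^d$ such that: (1) $D$ and the $D_m$ satisfy (i) and (ii) below; (2) if $x_m\in\bar D_m$ and $x_m\to x$, then $x\in\bar D$; (3) every compact $K\subset D$ is contained in $D_m$ for $m$ large enough. The conditions are: (i) there is $C_0$ such that $(x'-x,n(x))+C_0|x-x'|^2\ge0$ for all $x\in\partial D$, $x'\in\bar D$; (ii) for all $x\in\partial D$, if $k\in\mathbb{R}^d$ and $C\ge0$ satisfy $(x'-x,k)+C|x-x'|^2\ge0$ for all $x'\in\bar D$, then $k=\theta n(x)$ for some $\theta\ge0$. *)

theory Defs
  imports "HOL-Analysis.Analysis"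
begin

section \<open>Domains of class \<open>C\<^sup>k\<close> and their inward normals\<close>

text \<open>All partial derivatives of order at most \<open>k\<close> exist as (total) derivatives of the
  previous ones, and are continuous.\<close>

primrec Ck_fun :: "nat \<Rightarrow> ('a::euclidean_space \<Rightarrow> real) \<Rightarrow> bool" where
  "Ck_fun 0 f \<longleftrightarrow> continuous_on UNIV f"
| "Ck_fun (Suc k) f \<longleftrightarrow> (\<forall>x. f differentiable (at x)) \<and>
     (\<forall>b\<in>Basis. Ck_fun k (\<lambda>x. frechet_derivative f (at x) b))"

definition of_class_C :: "enat \<Rightarrow> ('a::euclidean_space \<Rightarrow> real) \<Rightarrow> bool" where
  "of_class_C k f \<longleftrightarrow> (\<forall>i. enat i \<le> k \<longrightarrow> Ck_fun i f)"

text \<open>The height above the graph of \<open>\<gamma>\<close>, in the direction of the unit vector \<open>e\<close>.  A function of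
  \<open>d - 1\<close> variables is encoded as a function \<open>\<gamma>\<close> on the whole space which is only evaluated on
  the hyperplane orthogonal to \<open>e\<close>, that is at \<open>y - (y \<bullet> e) e\<close>.\<close>

definition height_above :: "'a::euclidean_space \<Rightarrow> ('a \<Rightarrow> real) \<Rightarrow> 'a \<Rightarrow> real" where
  "height_above e \<gamma> y = y \<bullet> e - \<gamma> (y - (y \<bullet> e) *\<^sub>R e)"

text \<open>Near \<open>p\<close>, and up to a choice of orthonormal coordinates, the set \<open>D\<close> is the region
  above the graph of a \<open>C\<^sup>k\<close> function.\<close>

definition boundary_chart ::
    "enat \<Rightarrow> 'a::euclidean_space set \<Rightarrow> 'a \<Rightarrow> real \<Rightarrow> 'a \<Rightarrow> ('a \<Rightarrow> real) \<Rightarrow> bool" where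
  "boundary_chart k D p r e \<gamma> \<longleftrightarrow>
     r > 0 \<and> norm e = 1 \<and> of_class_C k \<gamma> \<and>
     D \<inter> ball p r = {y \<in> ball p r. height_above e \<gamma> y > 0}"

definition Ck_open_set :: "enat \<Rightarrow> 'a::euclidean_space set \<Rightarrow> bool" where
  "Ck_open_set k D \<longleftrightarrow> open D \<and> (\<forall>p\<in>frontier D. \<exists>r e \<gamma>. boundary_chart k D p r e \<gamma>)"

definition Ck_domain :: "enat \<Rightarrow> 'a::euclidean_space set \<Rightarrow> bool" where
  "Ck_domain k D \<longleftrightarrow> Ck_open_set k D \<and> connected D"

text \<open>The height function vanishes on the boundary and is positive in \<open>D\<close>, so the inward unit
  normal is its normalised gradient (which is nonzero, and does not depend on the chart).\<close>

definition inward_unit_normal :: "'a::euclidean_space set \<Rightarrow> 'a \<Rightarrow> 'a \<Rightarrow> bool" where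
  "inward_unit_normal D p v \<longleftrightarrow>
     (\<exists>r e \<gamma> g. boundary_chart 1 D p r e \<gamma> \<and> (GDERIV (height_above e \<gamma>) p :> g) \<and> v = sgn g)"

text \<open>The values of \<open>n\<close> off the boundary are irrelevant, here and in all that follows.\<close>

definition inward_unit_normal_field ::
    "'a::euclidean_space set \<Rightarrow> ('a \<Rightarrow> 'a) \<Rightarrow> bool" where
  "inward_unit_normal_field D n \<longleftrightarrow> (\<forall>p\<in>frontier D. inward_unit_normal D p (n p))"


section \<open>Admissible domains\<close>

definition exterior_ball_condition :: "'a::euclidean_space set \<Rightarrow> ('a \<Rightarrow> 'a) \<Rightarrow> bool" where
  "exterior_ball_condition D n \<longleftrightarrow>
     (\<exists>C0. \<forall>x\<in>frontier D. \<forall>x'\<in>closure D. (x' - x) \<bullet> n x + C0 * (norm (x - x'))\<^sup>2 \<ge> 0)"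

definition normal_cone_condition :: "'a::euclidean_space set \<Rightarrow> ('a \<Rightarrow> 'a) \<Rightarrow> bool" where
  "normal_cone_condition D n \<longleftrightarrow>
     (\<forall>x\<in>frontier D. \<forall>k C. C \<ge> 0 \<longrightarrow>
        (\<forall>x'\<in>closure D. (x' - x) \<bullet> k + C * (norm (x - x'))\<^sup>2 \<ge> 0) \<longrightarrow>
        (\<exists>\<theta>\<ge>0. k = \<theta> *\<^sub>R n x))"

text \<open>Here \<open>n\<close> is the inward unit normal field of \<open>D\<close>; each approximating set comes with
  its own normal field \<open>nm m\<close>, and the constant in \<open>exterior_ball_condition\<close> may depend on \<open>m\<close>.\<close>

definition admissible :: "'a::euclidean_space set \<Rightarrow> ('a \<Rightarrow> 'a) \<Rightarrow> bool" where
  "admissible D n \<longleftrightarrow>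
     (\<exists>(Dm :: nat \<Rightarrow> 'a set) (nm :: nat \<Rightarrow> 'a \<Rightarrow> 'a).
        (\<forall>m. bounded (Dm m) \<and> Ck_open_set \<infinity> (Dm m) \<and> inward_unit_normal_field (Dm m) (nm m)) \<and>
        exterior_ball_condition D n \<and> normal_cone_condition D n \<and>
        (\<forall>m. exterior_ball_condition (Dm m) (nm m) \<and> normal_cone_condition (Dm m) (nm m)) \<and>
        (\<forall>X x. (\<forall>m. X m \<in> closure (Dm m)) \<longrightarrow> X \<longlonglongrightarrow> x \<longrightarrow> x \<in> closure D) \<and>
        (\<forall>K. compact K \<longrightarrow> K \<subseteq> D \<longrightarrow> eventually (\<lambda>m. K \<subseteq> Dm m) sequentially))"

definition sup0 :: "real set \<Rightarrow> real" where
  "sup0 A = (if A = {} then 0 else Sup A)"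


section \<open>The extended Skorohod problem\<close>

definition total_variation :: "real set \<Rightarrow> (real \<Rightarrow> 'a::real_normed_vector) \<Rightarrow> ennreal" where
  "total_variation S f =
     (SUP (N, t) \<in> {(N, t). mono_on {..N} t \<and> t ` {..N} \<subseteq> S}.
        \<Sum>i<(N::nat). ennreal (norm (f (t (Suc i)) - f (t i))))"

definition bounded_variation_on :: "real set \<Rightarrow> (real \<Rightarrow> 'a::real_normed_vector) \<Rightarrow> bool" where
  "bounded_variation_on S f \<longleftrightarrow> total_variation S f < \<infinity>"

definition variation_upto :: "(real \<Rightarrow> 'a::real_normed_vector) \<Rightarrow> real \<Rightarrow> real" where
  "variation_upto L t = enn2real (total_variation {0..t} L)"

text \<open>The Stieltjes measure \<open>d|L|\<close>.  Since \<open>variation_upto L\<close> vanishes on the negative half line,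
  this measure is carried by \<open>{0..}\<close>; it has no atoms when \<open>L\<close> is continuous.\<close>

definition variation_measure :: "(real \<Rightarrow> 'a::real_normed_vector) \<Rightarrow> real measure" where
  "variation_measure L = interval_measure (variation_upto L)"

text \<open>Paths indexed by \<open>[0, \<infinity>)\<close> are functions on the reals of which only the restriction to
  \<open>{0..}\<close> matters.  As \<open>n\<close> is meaningful only on the boundary, \<open>\<integral> n(x\<^sub>s) d|L|\<^sub>s\<close>
  is taken over the times at which \<open>x\<close> is on the boundary; the condition on \<open>|L|\<close> says that
  the remaining times are \<open>d|L|\<close>-null.\<close>

definition extended_skorohod_solution ::
    "(real \<Rightarrow> 'a::euclidean_space) \<Rightarrow> 'a set \<Rightarrow> ('a \<Rightarrow> 'a) \<Rightarrow>
     (real \<Rightarrow> 'a) \<Rightarrow> (real \<Rightarrow> 'a) \<Rightarrow> bool" where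
  "extended_skorohod_solution w D n x L \<longleftrightarrow>
     continuous_on {0..} x \<and> (\<forall>t\<ge>0. x t \<in> closure D) \<and>
     continuous_on {0..} L \<and> (\<forall>T>0. bounded_variation_on {0<..<T} L) \<and>
     (\<forall>t\<ge>0. variation_upto L t =
        (LINT s:{0..t}|variation_measure L. indicator {s. x s \<in> frontier D} s)) \<and>
     (\<forall>t\<ge>0. set_integrable (variation_measure L) {s\<in>{0..t}. x s \<in> frontier D} (\<lambda>s. n (x s)) \<and>
        L t = (LINT s:{s\<in>{0..t}. x s \<in> frontier D}|variation_measure L. n (x s))) \<and>
     (\<forall>t\<ge>0. x t = w t + integral {0..t} L + L t)"

end

theory Submission
  imports Defs "HOL-Complex_Analysis.Great_Picard"
begin

text \<open>The solution is a limit of projected Euler schemes.  With step \<open>h\<close>, the scheme moves the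
  current point by the increment of \<open>w\<close> plus \<open>h\<close> times the push accumulated so far, and then
  replaces the result by a nearest point of \<open>closure D\<close>.  A nearest point \<open>p\<close> of \<open>y\<close> satisfies
  \<open>(x' - p) \<bullet> (p - y) + |x' - p|\<^sup>2 / 2 \<ge> 0\<close> for all \<open>x'\<close> in the closure, so the normal cone
  condition says that the correction \<open>p - y\<close> is a nonnegative multiple of \<open>n p\<close>
  (\<open>projection_step\<close>).

  The proof rests on compactness of these schemes (\<open>uniform_oscillation\<close>), which has two sources.
  First, the feedback \<open>\<integral> L\<close> is harmless: \<open>L + \<integral> L = x - w\<close> is bounded because \<open>D\<close> is, and
  this linear equation for \<open>\<integral> L\<close> bounds \<open>\<integral> L\<close> and \<open>L\<close>, whatever the variation of \<open>L\<close> may be.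
  Hence the drive \<open>w + \<integral> L\<close> has a modulus of continuity that does not depend on the step.
  Second, let the path stay within \<open>\<rho>\<close> of its initial position on some time interval on which
  the drive oscillates by at most \<open>\<eta>\<close>.  The exterior ball condition then bounds the square of the
  total push by \<open>2 (C\<^sub>0 \<rho>\<^sup>2 + \<eta>)\<close> times its variation; and since the normals met on the way are
  almost parallel, the variation is at most twice the norm of the push.  So both are of order
  \<open>C\<^sub>0 \<rho>\<^sup>2 + \<eta>\<close>, which is much smaller than \<open>\<rho>\<close>: the path cannot leave the \<open>\<rho>\<close>-ball, and the
  estimate holds on every interval on which the drive oscillates little.

  Arzela-Ascoli then yields a locally uniform limit of the push, its integral and its variation.
  The equation \<open>dL = n(x) d|L|\<close> passes to the limit as an inequality on short intervals: if
  \<open>x r\<close> is on the boundary for some \<open>r\<close> in the interval, the increment of \<open>L\<close> differs from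
  \<open>n (x r)\<close> times that of the variation by at most \<open>e\<close> times the latter.  These inequalities,
  together with the fact that the variation is constant while \<open>x\<close> is inside \<open>D\<close>, determine the
  total variation of \<open>L\<close> and its Stieltjes representation (\<open>solves_extended_skorohod\<close>).

  Both the near-parallelism of the normals and the passage to the limit rely on the uniform
  continuity of \<open>n\<close> on the compact boundary, which follows from the local Lipschitz bound.\<close>

section \<open>Domains with a continuous normal field\<close>

locale reflecting_domain =
  fixes D :: "'a::euclidean_space set" and n :: "'a \<Rightarrow> 'a" and C\<^sub>0 :: real
  assumes open_D: "open D" and bounded_D: "bounded D"
    and norm_normal: "x \<in> frontier D \<Longrightarrow> norm (n x) = 1"
    and continuous_normal: "continuous_on (frontier D) n"
    and C\<^sub>0_nonneg: "C\<^sub>0 \<ge> 0"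
    and exterior_ball: "\<lbrakk>x \<in> frontier D; y \<in> closure D\<rbrakk> \<Longrightarrow> (y - x) \<bullet> n x + C\<^sub>0 * (norm (x - y))\<^sup>2 \<ge> 0"
    and normal_cone: "normal_cone_condition D n"
begin

lemma closure_cases: "x \<in> closure D \<Longrightarrow> x \<notin> frontier D \<Longrightarrow> x \<in> D"
  using open_D by (simp add: frontier_def interior_open)

lemma compact_frontier_D: "compact (frontier D)"
  using bounded_D by (rule compact_frontier_bounded)

lemma normal_uniformly_continuous:
  assumes "e > 0"
  obtains d where "d > 0"
    "\<And>x y. \<lbrakk>x \<in> frontier D; y \<in> frontier D; norm (x - y) < d\<rbrakk> \<Longrightarrow> norm (n x - n y) < e"
proof -
  have "uniformly_continuous_on (frontier D) n"
    using compact_uniformly_continuous[OF continuous_normal compact_frontier_D] .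
  with assms show ?thesis
    using that unfolding uniformly_continuous_on_def dist_norm by metis
qed

text \<open>The obtuse angle property of a nearest point \<open>p\<close> of \<open>z + u\<close>, with error term
  \<open>|y - p|\<^sup>2 / 2\<close>, is the hypothesis of the normal cone condition for \<open>k = p - (z + u)\<close>.  The bound
  \<open>\<theta> \<le> norm u\<close> holds because \<open>z\<close> itself competes for the nearest point.\<close>

lemma projection_step:
  assumes z: "z \<in> closure D"
  shows "\<exists>x \<theta>. x \<in> closure D \<and> 0 \<le> \<theta> \<and> (\<theta> \<noteq> 0 \<longrightarrow> x \<in> frontier D) \<and> \<theta> \<le> norm u \<and>
    x = z + u + \<theta> *\<^sub>R n x"
proof (cases "z + u \<in> closure D")
  case True
  then show ?thesis by (intro exI[of _ "z + u"] exI[of _ 0]) auto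
next
  case False
  define p where "p = closest_point (closure D) (z + u)"
  have ne: "closure D \<noteq> {}" using z by auto
  have pD: "p \<in> closure D"
    unfolding p_def by (rule closest_point_in_set) (use ne in auto)
  have closest: "dist (z + u) p \<le> dist (z + u) y" if "y \<in> closure D" for y
    using closest_point_exists(2)[OF closed_closure ne, of "z + u"] that by (simp add: p_def)
  have obtuse: "(y - p) \<bullet> (p - (z + u)) + 1/2 * (norm (p - y))\<^sup>2 \<ge> 0" if "y \<in> closure D" for y
  proof -
    have "(norm (p - (z + u)))\<^sup>2 \<le> (norm (y - (z + u)))\<^sup>2"
      using closest[OF that] by (simp add: dist_norm norm_minus_commute)
    also have "y - (z + u) = (y - p) + (p - (z + u))" by simp
    also have "(norm \<dots>)\<^sup>2 = (norm (y - p))\<^sup>2 + (norm (p - (z + u)))\<^sup>2 + 2 * ((y - p) \<bullet> (p - (z + u)))"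
      by (simp only: power2_norm_eq_inner inner_add_left inner_add_right) (simp add: inner_commute)
    finally show ?thesis by (simp add: norm_minus_commute)
  qed
  define k where "k = p - (z + u)"
  have k: "norm k > 0" using pD False by (auto simp: k_def)
  have pF: "p \<in> frontier D"
  proof (rule ccontr)
    assume "p \<notin> frontier D"
    \<comment> \<open>Otherwise a small move from \<open>p\<close> towards \<open>z + u\<close> stays in \<open>D\<close> and comes closer to \<open>z + u\<close>.\<close>
    then obtain \<epsilon> where \<epsilon>: "\<epsilon> > 0" "ball p \<epsilon> \<subseteq> D"
      using closure_cases[OF pD] open_D by (meson open_contains_ball)
    define s where "s = min 1 (\<epsilon> / (2 * norm k))"
    have s: "0 < s" "s \<le> 1" "s \<le> \<epsilon> / (2 * norm k)" using \<epsilon>(1) k by (auto simp: s_def)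
    then have "s * norm k < \<epsilon>" using \<epsilon>(1) k by (simp add: field_simps)
    then have "p - s *\<^sub>R k \<in> closure D" using s(1) \<epsilon> closure_subset by (force simp: dist_norm)
    from obtuse[OF this] have "s * (norm k)\<^sup>2 \<le> 1/2 * s\<^sup>2 * (norm k)\<^sup>2"
      unfolding k_def[symmetric] using s
      by (simp add: power_mult_distrib power2_norm_eq_inner del: power2_eq_iff_nonneg)
    then have "s \<le> 1/2 * s\<^sup>2" using k by simp
    then show False using s by (simp add: power2_eq_square)
  qed
  obtain \<theta> where \<theta>: "\<theta> \<ge> 0" "p - (z + u) = \<theta> *\<^sub>R n p"
    using normal_cone pF obtuse unfolding normal_cone_condition_def
    by (metis zero_le_divide_1_iff zero_le_numeral)
  have "\<theta> = norm (p - (z + u))" using \<theta> norm_normal[OF pF] by simp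
  also have "\<dots> \<le> norm u" using closest[OF z] by (simp add: dist_norm norm_minus_commute)
  finally have "\<theta> \<le> norm u" .
  moreover have "p = z + u + \<theta> *\<^sub>R n p" using \<theta>(2) by (simp add: algebra_simps)
  ultimately show ?thesis using pD pF \<theta>(1) by blast
qed

end

section \<open>The projected Euler scheme\<close>

text \<open>\<open>X\<close> is the position, \<open>Y\<close> the accumulated push, \<open>A\<close> the Riemann sum for the integral of the push,
  and \<open>l\<close> the variation of the push.  The increments of \<open>l\<close> are the lengths of the projection
  moves, so no move happens unless it ends on the boundary.\<close>

locale projected_euler = reflecting_domain D n C\<^sub>0
  for D :: "'a::euclidean_space set" and n :: "'a \<Rightarrow> 'a" and C\<^sub>0 :: real +
  fixes w :: "real \<Rightarrow> 'a" and h :: real and X Y A :: "nat \<Rightarrow> 'a" and l :: "nat \<Rightarrow> real"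
  assumes h: "0 < h" "h \<le> 1"
    and X_closure: "X k \<in> closure D"
    and start: "Y 0 = 0" "A 0 = 0" "l 0 = 0"
    and X_eq: "X k = w (h * k) + A k + Y k"
    and A_Suc: "A (Suc k) = A k + h *\<^sub>R Y k"
    and Y_Suc: "Y (Suc k) = Y k + (l (Suc k) - l k) *\<^sub>R n (X (Suc k))"
    and l_Suc: "l k \<le> l (Suc k)"
    and l_frontier: "l (Suc k) \<noteq> l k \<Longrightarrow> X (Suc k) \<in> frontier D"
    and push_le: "l (Suc k) - l k \<le> norm (w (h * Suc k) - w (h * k) + h *\<^sub>R Y k)"

lemma (in reflecting_domain) projected_euler_exists:
  assumes w0: "w 0 \<in> D" and h: "0 < h" "h \<le> 1"
  shows "\<exists>X Y A l. projected_euler D n C\<^sub>0 w h X Y A l"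
proof -
  define inv where "inv k s \<longleftrightarrow> (case s of (x, y, a, c) \<Rightarrow> x \<in> closure D \<and> x = w (h * real k) + a + y \<and>
      (k = 0 \<longrightarrow> y = 0 \<and> a = 0 \<and> c = 0))" for k :: nat and s :: "'a \<times> 'a \<times> 'a \<times> real"
  define step where "step k s s' \<longleftrightarrow> (case (s, s') of ((x, y, a, c), (x', y', a', c')) \<Rightarrow>
      a' = a + h *\<^sub>R y \<and> y' = y + (c' - c) *\<^sub>R n x' \<and> c \<le> c' \<and> (c' \<noteq> c \<longrightarrow> x' \<in> frontier D) \<and>
      c' - c \<le> norm (w (h * Suc k) - w (h * real k) + h *\<^sub>R y))"
    for k :: nat and s s' :: "'a \<times> 'a \<times> 'a \<times> real"
  have "\<exists>s. \<forall>k. inv k (s k) \<and> step k (s k) (s (Suc k))"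
  proof (rule dependent_nat_choice)
    show "\<exists>s. inv 0 s"
      by (rule exI[of _ "(w 0, 0, 0, 0)"]) (use w0 closure_subset in \<open>auto simp: inv_def\<close>)
  next
    fix s k assume "inv k s"
    then obtain x y a c where s: "s = (x, y, a, c)" and x: "x \<in> closure D" "x = w (h * real k) + a + y"
      by (cases s) (auto simp: inv_def)
    define u where "u = w (h * Suc k) - w (h * real k) + h *\<^sub>R y"
    obtain x' \<theta> where "x' \<in> closure D" "0 \<le> \<theta>" "\<theta> \<noteq> 0 \<longrightarrow> x' \<in> frontier D" "\<theta> \<le> norm u"
      and x': "x' = x + u + \<theta> *\<^sub>R n x'"
      using projection_step[OF x(1)] by blast
    moreover have "x' = w (h * Suc k) + (a + h *\<^sub>R y) + (y + \<theta> *\<^sub>R n x')"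
      by (subst x') (simp add: u_def x(2))
    ultimately have "inv (Suc k) (x', y + \<theta> *\<^sub>R n x', a + h *\<^sub>R y, c + \<theta>) \<and>
        step k s (x', y + \<theta> *\<^sub>R n x', a + h *\<^sub>R y, c + \<theta>)"
      by (simp add: inv_def step_def s u_def)
    then show "\<exists>s'. inv (Suc k) s' \<and> step k s s'" by blast
  qed
  then obtain s where s: "inv k (s k)" "step k (s k) (s (Suc k))" for k by blast
  define X where "X k = fst (s k)" for k
  define Y where "Y k = fst (snd (s k))" for k
  define A where "A k = fst (snd (snd (s k)))" for k
  define l where "l k = snd (snd (snd (s k)))" for k
  have sk: "s k = (X k, Y k, A k, l k)" for k by (simp add: X_def Y_def A_def l_def)
  have I: "X k \<in> closure D" "X k = w (h * k) + A k + Y k" for k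
    using s(1)[of k] by (auto simp: inv_def sk)
  have Z: "Y 0 = 0" "A 0 = 0" "l 0 = 0"
    using s(1)[of 0] by (auto simp: inv_def sk)
  have S: "A (Suc k) = A k + h *\<^sub>R Y k" "Y (Suc k) = Y k + (l (Suc k) - l k) *\<^sub>R n (X (Suc k))"
    "l k \<le> l (Suc k)" "l (Suc k) \<noteq> l k \<Longrightarrow> X (Suc k) \<in> frontier D"
    "l (Suc k) - l k \<le> norm (w (h * Suc k) - w (h * k) + h *\<^sub>R Y k)" for k
    using s(2)[of k] by (auto simp: step_def sk)
  have "projected_euler D n C\<^sub>0 w h X Y A l"
    by unfold_locales (use h I Z S in auto)
  then show ?thesis by blast
qed

context projected_euler
begin

lemma l_mono: "i \<le> k \<Longrightarrow> l i \<le> l k"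
  using l_Suc by (rule lift_Suc_mono_le)

text \<open>Increments of \<open>Y\<close> are sums of the normals met, weighted by increments of \<open>l\<close>; this is the
  discrete form of \<open>dL = n(x) d|L|\<close>, stated in a way that survives the passage to the limit.\<close>

lemma Y_increment_close:
  assumes "i \<le> k" and "\<And>j. \<lbrakk>i < j; j \<le> k; X j \<in> frontier D\<rbrakk> \<Longrightarrow> norm (n (X j) - c) \<le> e"
  shows "norm (Y k - Y i - (l k - l i) *\<^sub>R c) \<le> e * (l k - l i)"
  using assms
proof (induction k rule: dec_induct)
  case base
  show ?case by simp
next
  case (step k)
  have "norm ((l (Suc k) - l k) *\<^sub>R (n (X (Suc k)) - c)) \<le> e * (l (Suc k) - l k)"
  proof (cases "l (Suc k) = l k")
    case False
    then have "norm (n (X (Suc k)) - c) \<le> e"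
      using step.prems[of "Suc k"] step.hyps l_frontier by auto
    then show ?thesis using l_Suc[of k] by (simp add: mult.commute[of e] mult_left_mono)
  qed auto
  moreover have "norm (Y k - Y i - (l k - l i) *\<^sub>R c) \<le> e * (l k - l i)"
    using step by simp
  moreover have "Y (Suc k) - Y i - (l (Suc k) - l i) *\<^sub>R c
      = (Y k - Y i - (l k - l i) *\<^sub>R c) + (l (Suc k) - l k) *\<^sub>R (n (X (Suc k)) - c)"
    by (simp add: Y_Suc algebra_simps)
  ultimately show ?case
    by (smt (verit, best) norm_triangle_ineq distrib_left)
qed

lemma Y_increment_le: "i \<le> k \<Longrightarrow> norm (Y k - Y i) \<le> l k - l i"
  using Y_increment_close[of i k 0 1] norm_normal by simp

lemma l_constant:
  assumes "i \<le> k" and "\<And>j. \<lbrakk>i < j; j \<le> k\<rbrakk> \<Longrightarrow> X j \<notin> frontier D"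
  shows "l k = l i"
  using assms
proof (induction k rule: dec_induct)
  case (step k)
  then show ?case using l_frontier[of k] by fastforce
qed simp

lemma A_increment_close:
  assumes "i \<le> k" and "\<And>j. \<lbrakk>i \<le> j; j < k\<rbrakk> \<Longrightarrow> norm (Y j - c) \<le> e"
  shows "norm (A k - A i - (h * (real k - real i)) *\<^sub>R c) \<le> e * (h * (real k - real i))"
  using assms
proof (induction k rule: dec_induct)
  case base
  show ?case by simp
next
  case (step k)
  have "norm (h *\<^sub>R (Y k - c)) \<le> e * h"
    using step.prems[of k] step.hyps h by (simp add: mult.commute)
  moreover have "norm (A k - A i - (h * (real k - real i)) *\<^sub>R c) \<le> e * (h * (real k - real i))"
    using step by simp
  moreover have "A (Suc k) - A i - (h * (real (Suc k) - real i)) *\<^sub>R c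
      = (A k - A i - (h * (real k - real i)) *\<^sub>R c) + h *\<^sub>R (Y k - c)"
    by (simp add: A_Suc algebra_simps)
  moreover have "e * (h * (real (Suc k) - real i)) = e * (h * (real k - real i)) + e * h"
    by (simp add: algebra_simps)
  ultimately show ?case
    by (smt (verit, best) norm_triangle_ineq)
qed

text \<open>Since \<open>A + Y = X - w\<close> at grid times, \<open>A (Suc k)\<close> is the convex combination of \<open>A k\<close> and \<open>X k - w (h k)\<close>
  with weights \<open>1 - h\<close> and \<open>h\<close>.  This is where \<open>h \<le> 1\<close> matters.\<close>

lemma A_bound:
  assumes "\<And>j. j < k \<Longrightarrow> norm (X j - w (h * j)) \<le> M" and "M \<ge> 0"
  shows "norm (A k) \<le> M"
  using assms(1)
proof (induction k)
  case (Suc k)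
  have "A (Suc k) = (1 - h) *\<^sub>R A k + h *\<^sub>R (X k - w (h * k))"
    by (simp add: A_Suc X_eq algebra_simps)
  then have "norm (A (Suc k)) \<le> norm ((1 - h) *\<^sub>R A k) + norm (h *\<^sub>R (X k - w (h * k)))"
    by (metis norm_triangle_ineq)
  also have "\<dots> \<le> (1 - h) * M + h * M"
    using Suc h by (auto intro!: add_mono mult_left_mono)
  finally show ?case by (simp add: algebra_simps)
qed (simp add: start assms)

lemma Y_bound:
  assumes "\<And>j. j \<le> k \<Longrightarrow> norm (X j - w (h * j)) \<le> M" and "M \<ge> 0"
  shows "norm (Y k) \<le> 2 * M"
proof -
  have "Y k = (X k - w (h * k)) - A k" by (simp add: X_eq)
  then have "norm (Y k) \<le> norm (X k - w (h * k)) + norm (A k)" by (metis norm_triangle_ineq4)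
  with assms A_bound[of k M] show ?thesis by fastforce
qed

text \<open>The square of the push grows by at most \<open>2 \<theta> n(x) \<bullet> (Y (Suc k) - Y i)\<close> in a step of length
  \<open>\<theta>\<close> ending at \<open>x\<close>.  Up to the drive, \<open>Y (Suc k) - Y i\<close> is \<open>x - X i\<close>, and the exterior ball at
  \<open>x\<close> prevents \<open>n(x)\<close> from pointing away from \<open>X i\<close> to first order.\<close>

lemma energy_estimate:
  assumes "i \<le> k" and "\<rho> \<ge> 0"
    and "\<And>j. \<lbrakk>i \<le> j; j \<le> k\<rbrakk> \<Longrightarrow> norm (X j - X i) \<le> \<rho>"
    and "\<And>j. \<lbrakk>i \<le> j; j \<le> k\<rbrakk> \<Longrightarrow> norm (w (h * j) + A j - (w (h * i) + A i)) \<le> \<eta>"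
  shows "(norm (Y k - Y i))\<^sup>2 \<le> 2 * (C\<^sub>0 * \<rho>\<^sup>2 + \<eta>) * (l k - l i)"
  using assms(1,3,4)
proof (induction k rule: dec_induct)
  case (step k)
  define \<theta> x where "\<theta> = l (Suc k) - l k" and "x = X (Suc k)"
  have \<theta>: "\<theta> \<ge> 0" using l_Suc by (simp add: \<theta>_def)
  have dY: "Y (Suc k) - Y i = (Y k - Y i) + \<theta> *\<^sub>R n x" by (simp add: Y_Suc \<theta>_def x_def)
  have "\<theta> * (n x \<bullet> (Y (Suc k) - Y i)) \<le> \<theta> * (C\<^sub>0 * \<rho>\<^sup>2 + \<eta>)"
  proof (cases "\<theta> = 0")
    case False
    then have xF: "x \<in> frontier D" using l_frontier by (simp add: \<theta>_def x_def)
    define v where "v = w (h * Suc k) + A (Suc k) - (w (h * i) + A i)"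
    have Yv: "Y (Suc k) - Y i = (x - X i) - v"
      unfolding x_def v_def X_eq[of "Suc k"] X_eq[of i] by simp
    have "\<bar>n x \<bullet> v\<bar> \<le> \<eta>"
      using Cauchy_Schwarz_ineq2[of "n x" v] norm_normal[OF xF] step.prems(2)[of "Suc k"] step.hyps
      by (simp add: v_def)
    moreover have "(norm (x - X i))\<^sup>2 \<le> \<rho>\<^sup>2"
      using step.prems(1)[of "Suc k"] step.hyps by (auto simp: x_def intro: power_mono)
    then have "C\<^sub>0 * (norm (x - X i))\<^sup>2 \<le> C\<^sub>0 * \<rho>\<^sup>2"
      using C\<^sub>0_nonneg mult_left_mono by blast
    moreover have "n x \<bullet> (x - X i) \<le> C\<^sub>0 * (norm (x - X i))\<^sup>2"
      using exterior_ball[OF xF X_closure[of i]] by (simp add: inner_commute inner_diff_right)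
    ultimately have "n x \<bullet> (Y (Suc k) - Y i) \<le> C\<^sub>0 * \<rho>\<^sup>2 + \<eta>"
      unfolding Yv inner_diff_right[of _ "x - X i"] by linarith
    then show ?thesis using \<theta> by (rule mult_left_mono)
  qed simp
  moreover have "(norm (Y k - Y i))\<^sup>2 = (norm (Y (Suc k) - Y i))\<^sup>2
      - 2 * \<theta> * (n x \<bullet> (Y (Suc k) - Y i)) + \<theta>\<^sup>2 * (norm (n x))\<^sup>2"
    unfolding dY power2_norm_eq_inner
    by (simp add: inner_add_left inner_add_right inner_commute algebra_simps power2_eq_square)
  moreover have "\<theta>\<^sup>2 * (norm (n x))\<^sup>2 \<ge> 0" by simp
  moreover have "(norm (Y k - Y i))\<^sup>2 \<le> 2 * (C\<^sub>0 * \<rho>\<^sup>2 + \<eta>) * (l k - l i)"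
    using step by simp
  moreover have "2 * (C\<^sub>0 * \<rho>\<^sup>2 + \<eta>) * (l (Suc k) - l i)
      = 2 * (C\<^sub>0 * \<rho>\<^sup>2 + \<eta>) * (l k - l i) + 2 * (\<theta> * (C\<^sub>0 * \<rho>\<^sup>2 + \<eta>))"
    by (simp add: \<theta>_def algebra_simps)
  ultimately show ?case by linarith
qed simp

text \<open>If any boundary point is met, all normals met are within \<open>1/2\<close> of the normal at that point, so
  the pushes cannot cancel.\<close>

lemma l_increment_le:
  assumes "i \<le> k"
    and near: "\<And>j. \<lbrakk>i \<le> j; j \<le> k\<rbrakk> \<Longrightarrow> norm (X j - X i) \<le> \<rho>"
    and flat: "\<And>x y. \<lbrakk>x \<in> frontier D; y \<in> frontier D; norm (x - y) \<le> 2 * \<rho>\<rbrakk> \<Longrightarrow> norm (n x - n y) \<le> 1/2"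
  shows "l k - l i \<le> 2 * norm (Y k - Y i)"
proof (cases "\<exists>m. i < m \<and> m \<le> k \<and> X m \<in> frontier D")
  case True
  then obtain m where m: "i < m" "m \<le> k" "X m \<in> frontier D" by blast
  have "norm (n (X j) - n (X m)) \<le> 1/2" if "i < j" "j \<le> k" "X j \<in> frontier D" for j
  proof (rule flat)
    have "norm (X j - X m) \<le> norm (X j - X i) + norm (X m - X i)"
      using norm_triangle_ineq4[of "X j - X i" "X m - X i"] by simp
    then show "norm (X j - X m) \<le> 2 * \<rho>" using near[of j] near[of m] m that by simp
  qed (use that m in auto)
  then have "norm (Y k - Y i - (l k - l i) *\<^sub>R n (X m)) \<le> 1/2 * (l k - l i)"
    by (intro Y_increment_close[OF assms(1)]) auto
  moreover have "norm ((l k - l i) *\<^sub>R n (X m)) = l k - l i"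
    using l_mono[OF assms(1)] norm_normal[OF m(3)] by simp
  moreover have "norm ((l k - l i) *\<^sub>R n (X m)) \<le> norm (Y k - Y i) + norm (Y k - Y i - (l k - l i) *\<^sub>R n (X m))"
    by (metis diff_diff_eq2 add_diff_cancel_left' norm_triangle_ineq4)
  ultimately have "l k - l i \<le> norm (Y k - Y i) + 1/2 * (l k - l i)" by linarith
  then show ?thesis by (simp add: field_simps)
next
  case False
  then show ?thesis using l_constant[OF assms(1)] by force
qed

text \<open>A continuity argument in discrete time.  As long as the path stays in the \<open>\<rho>\<close>-ball around
  \<open>X i\<close>, the previous two estimates put it in the ball of radius \<open>\<rho>/2\<close>; one step has length at most
  \<open>\<rho>/5\<close> and so cannot leave the \<open>\<rho>\<close>-ball.\<close>

lemma oscillation_estimate: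
  assumes "i \<le> k"
    and drive: "\<And>j. \<lbrakk>i \<le> j; j \<le> k\<rbrakk> \<Longrightarrow> norm (w (h * j) + A j - (w (h * i) + A i)) \<le> \<rho> / 20"
    and flat: "\<And>x y. \<lbrakk>x \<in> frontier D; y \<in> frontier D; norm (x - y) \<le> 2 * \<rho>\<rbrakk> \<Longrightarrow> norm (n x - n y) \<le> 1/2"
    and small: "16 * C\<^sub>0 * \<rho> \<le> 1"
    and "\<rho> > 0"
  shows "l k - l i \<le> \<rho>"
proof -
  \<comment> \<open>Dividing the energy estimate by the norm of the push gives at most \<open>4 (\<rho>/16 + \<rho>/20)\<close> for that norm.\<close>
  have conclude: "norm (X j - X i) \<le> \<rho>/2 \<and> l j - l i \<le> \<rho>"
    if j: "i \<le> j" "j \<le> k" and near: "\<And>m. \<lbrakk>i \<le> m; m \<le> j\<rbrakk> \<Longrightarrow> norm (X m - X i) \<le> \<rho>" for j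
  proof -
    have push: "l j - l i \<le> 2 * norm (Y j - Y i)"
      by (rule l_increment_le[OF j(1) near flat])
    have "(norm (Y j - Y i))\<^sup>2 \<le> 2 * (C\<^sub>0 * \<rho>\<^sup>2 + \<rho>/20) * (l j - l i)"
      using j near drive \<open>\<rho> > 0\<close> by (intro energy_estimate) auto
    also have "\<dots> \<le> 2 * (C\<^sub>0 * \<rho>\<^sup>2 + \<rho>/20) * (2 * norm (Y j - Y i))"
      using push C\<^sub>0_nonneg \<open>\<rho> > 0\<close> by (intro mult_left_mono) auto
    finally have "norm (Y j - Y i) * norm (Y j - Y i) \<le> 4 * (C\<^sub>0 * \<rho>\<^sup>2 + \<rho>/20) * norm (Y j - Y i)"
      by (simp add: power2_eq_square algebra_simps)
    then have "norm (Y j - Y i) \<le> 4 * (C\<^sub>0 * \<rho>\<^sup>2 + \<rho>/20) \<or> norm (Y j - Y i) = 0"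
      by (auto simp: mult_le_cancel_right)
    moreover have "C\<^sub>0 * \<rho>\<^sup>2 \<ge> 0" using C\<^sub>0_nonneg by simp
    ultimately have Yj: "norm (Y j - Y i) \<le> 4 * (C\<^sub>0 * \<rho>\<^sup>2) + \<rho>/5"
      using \<open>\<rho> > 0\<close> by auto
    have "16 * C\<^sub>0 * \<rho> * \<rho> \<le> 1 * \<rho>" using small \<open>\<rho> > 0\<close> by (intro mult_right_mono) auto
    then have C: "C\<^sub>0 * \<rho>\<^sup>2 \<le> \<rho>/16" by (simp add: power2_eq_square)
    have "X j - X i = (w (h * j) + A j - (w (h * i) + A i)) + (Y j - Y i)"
      by (simp add: X_eq[of i] X_eq[of j])
    then have "norm (X j - X i) \<le> norm (w (h * j) + A j - (w (h * i) + A i)) + norm (Y j - Y i)"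
      by (metis norm_triangle_ineq)
    with Yj C drive[OF j] have "norm (X j - X i) \<le> \<rho>/2" by linarith
    moreover have "l j - l i \<le> \<rho>"
      using push Yj C \<open>\<rho> > 0\<close> by linarith
    ultimately show ?thesis ..
  qed
  have "\<forall>m. i \<le> m \<and> m \<le> j \<longrightarrow> norm (X m - X i) \<le> \<rho>/2" if "i \<le> j" "j \<le> k" for j
    using that
  proof (induction j rule: dec_induct)
    case base
    then show ?case using \<open>\<rho> > 0\<close> by auto
  next
    case (step j)
    define v where "v = w (h * Suc j) + A (Suc j) - (w (h * j) + A j)"
    have v: "v = (w (h * Suc j) + A (Suc j) - (w (h * i) + A i)) - (w (h * j) + A j - (w (h * i) + A i))"
      by (simp add: v_def)
    have "norm v \<le> \<rho>/20 + \<rho>/20"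
      unfolding v using step by (intro order_trans[OF norm_triangle_ineq4] add_mono drive) auto
    moreover have "X (Suc j) - X j = v + (Y (Suc j) - Y j)"
      using X_eq[of "Suc j"] X_eq[of j] by (simp add: v_def)
    then have "X (Suc j) - X j = v + (l (Suc j) - l j) *\<^sub>R n (X (Suc j))"
      by (simp add: Y_Suc)
    then have "norm (X (Suc j) - X j) \<le> norm v + (l (Suc j) - l j) * norm (n (X (Suc j)))"
      by (metis norm_triangle_ineq norm_scaleR abs_of_nonneg diff_ge_0_iff_ge l_Suc)
    moreover have "(l (Suc j) - l j) * norm (n (X (Suc j))) \<le> l (Suc j) - l j"
      using l_frontier[of j] norm_normal by (cases "l (Suc j) = l j") auto
    moreover have "l (Suc j) - l j \<le> norm v"
      using push_le[of j] by (simp add: v_def A_Suc algebra_simps)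
    ultimately have jump: "norm (X (Suc j) - X j) \<le> \<rho>/5" by linarith
    have "norm (X j - X i) \<le> \<rho>/2" using step by simp
    moreover have "norm (X (Suc j) - X i) \<le> norm (X (Suc j) - X j) + norm (X j - X i)"
      using norm_triangle_ineq[of "X (Suc j) - X j" "X j - X i"] by simp
    ultimately have last: "norm (X (Suc j) - X i) \<le> \<rho>" using jump \<open>\<rho> > 0\<close> by linarith
    have "norm (X m - X i) \<le> \<rho>" if "i \<le> m" "m \<le> Suc j" for m
      using last step.IH step.prems that \<open>\<rho> > 0\<close>
      by (smt (verit, ccfv_SIG) Suc_leD field_sum_of_halves le_SucE)
    then have "norm (X (Suc j) - X i) \<le> \<rho>/2" using conclude[of "Suc j"] step by simp
    then show ?case using step by (auto simp: le_Suc_eq)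
  qed
  then have "norm (X m - X i) \<le> \<rho>" if "i \<le> m" "m \<le> k" for m
    using that \<open>i \<le> k\<close> \<open>\<rho> > 0\<close> by (smt (verit, ccfv_SIG) field_sum_of_halves le_refl)
  then show ?thesis using conclude[OF \<open>i \<le> k\<close> le_refl] by blast
qed

end

text \<open>The bound does not depend on the scheme, in particular not on its step: the drive \<open>w + A\<close> has a
  common modulus of continuity on \<open>{0..T}\<close> because \<open>Y\<close> is bounded there by \<open>2 M\<close>.\<close>

lemma (in reflecting_domain) uniform_oscillation:
  assumes w: "continuous_on {0..} w" and e: "e > 0" and T: "T \<ge> 0"
  obtains d where "d > 0"
    "\<And>h X Y A l i k. \<lbrakk>projected_euler D n C\<^sub>0 w h X Y A l; i \<le> k; h * k \<le> T; h * (real k - real i) \<le> d\<rbrakk>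
      \<Longrightarrow> l k - l i \<le> e \<and> norm (A k - A i) \<le> e"
proof -
  obtain R where R: "norm x \<le> R" if "x \<in> closure D" for x
    using bounded_closure[OF bounded_D] bounded_iff by blast
  have wT: "continuous_on {0..T} w" using w continuous_on_subset by fastforce
  then have "bounded (w ` {0..T})" by (intro compact_imp_bounded compact_continuous_image) auto
  then obtain W where W: "norm (w t) \<le> W" if "t \<in> {0..T}" for t
    unfolding bounded_iff by blast
  define M where "M = \<bar>R\<bar> + \<bar>W\<bar> + 1"
  have M: "M > 0" by (simp add: M_def)
  obtain d0 where d0: "d0 > 0"
    "\<And>x y. \<lbrakk>x \<in> frontier D; y \<in> frontier D; norm (x - y) < d0\<rbrakk> \<Longrightarrow> norm (n x - n y) < 1/2"
    using normal_uniformly_continuous[of "1/2"] by auto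
  define \<rho> where "\<rho> = min e (min (d0 / 3) (1 / (16 * (C\<^sub>0 + 1))))"
  have \<rho>: "\<rho> > 0" "\<rho> \<le> e" "2 * \<rho> < d0" using e d0(1) C\<^sub>0_nonneg by (auto simp: \<rho>_def)
  have "\<rho> \<le> 1 / (16 * (C\<^sub>0 + 1))" by (simp add: \<rho>_def)
  then have "16 * (C\<^sub>0 + 1) * \<rho> \<le> 1" using C\<^sub>0_nonneg by (simp add: field_simps)
  then have small: "16 * C\<^sub>0 * \<rho> \<le> 1" using \<rho>(1) by (simp add: algebra_simps)
  have "uniformly_continuous_on {0..T} w" using compact_uniformly_continuous[OF wT] by simp
  then obtain d1 where d1: "d1 > 0" "\<And>s t. \<lbrakk>s \<in> {0..T}; t \<in> {0..T}; dist t s < d1\<rbrakk> \<Longrightarrow> dist (w t) (w s) < \<rho>/40"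
    unfolding uniformly_continuous_on_def using \<rho>(1) by (metis divide_pos_pos zero_less_numeral)
  define d where "d = min (d1/2) (\<rho> / (80 * M))"
  have d: "d > 0" "d < d1" "d \<le> \<rho> / (80 * M)" using d1(1) \<rho>(1) M by (auto simp: d_def)
  have dM: "2 * M * d \<le> \<rho>/40" using d(3) M by (simp add: field_simps)
  show thesis
  proof (rule that[OF d(1)])
    fix h X Y A l and i k :: nat
    assume P: "projected_euler D n C\<^sub>0 w h X Y A l" and ik: "i \<le> k" "h * k \<le> T" "h * (real k - real i) \<le> d"
    interpret P: projected_euler D n C\<^sub>0 w h X Y A l by fact
    have mem: "h * j \<in> {0..T}" if "j \<le> k" for j :: nat
    proof -
      have "h * j \<le> h * k" using that P.h by (intro mult_left_mono) auto
      then have "h * j \<le> T" using ik(2) by linarith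
      then show ?thesis using P.h by auto
    qed
    have XM: "norm (X j - w (h * j)) \<le> M" if "j \<le> k" for j
      using norm_triangle_ineq4[of "X j" "w (h * j)"] R[OF P.X_closure[of j]] W[OF mem[OF that]]
      by (simp add: M_def)
    have YM: "norm (Y j) \<le> 2 * M" if "j \<le> k" for j
      using that M by (intro P.Y_bound XM) auto
    have A: "norm (A j - A i) \<le> \<rho>/40" if "i \<le> j" "j \<le> k" for j
    proof -
      have "norm (A j - A i - (h * (real j - real i)) *\<^sub>R 0) \<le> 2 * M * (h * (real j - real i))"
        using that YM by (intro P.A_increment_close) auto
      also have "h * (real j - real i) \<le> h * (real k - real i)"
        using that P.h by (intro mult_left_mono) auto
      then have "2 * M * (h * (real j - real i)) \<le> 2 * M * d" using ik M by (intro mult_left_mono) auto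
      finally show ?thesis using dM by simp
    qed
    have drive: "norm (w (h * j) + A j - (w (h * i) + A i)) \<le> \<rho>/20" if "i \<le> j" "j \<le> k" for j
    proof -
      have "\<bar>h * j - h * i\<bar> \<le> h * (real k - real i)"
        using that P.h by (simp add: right_diff_distrib)
      then have "dist (w (h * j)) (w (h * i)) < \<rho>/40"
        using that ik d by (intro d1(2) mem) (auto simp: dist_real_def)
      moreover have split: "w (h * j) + A j - (w (h * i) + A i) = (w (h * j) - w (h * i)) + (A j - A i)" by simp
      ultimately show ?thesis
        using A[OF that] norm_triangle_ineq[of "w (h * j) - w (h * i)" "A j - A i"]
      unfolding dist_norm split by linarith
    qed
    have "l k - l i \<le> \<rho>"
      using ik(1) drive small \<rho> d0(2) by (intro P.oscillation_estimate) (auto intro: less_imp_le)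
    then show "l k - l i \<le> e \<and> norm (A k - A i) \<le> e"
      using A[OF ik(1)] \<rho> by auto
  qed
qed

section \<open>Compactness\<close>

lemma fine_partition:
  fixes t d :: real
  assumes "t \<ge> 0" "d > 0"
  obtains N :: nat and s :: "nat \<Rightarrow> real"
  where "mono s" "s 0 = 0" "s N = t" "\<And>j. s (Suc j) - s j < d"
proof -
  obtain N :: nat where N: "t / d < N" using reals_Archimedean2 by blast
  have N0: "N > 0" using N assms by (metis divide_nonneg_pos not_gr_zero of_nat_0 not_less)
  define s where "s j = t * (real j / real N)" for j :: nat
  have "mono s" using assms(1)
    by (auto simp: s_def mono_def intro!: mult_left_mono divide_right_mono)
  moreover have "s (Suc j) - s j < d" for j
  proof -
    have "s (Suc j) - s j = t / N" by (simp add: s_def add_divide_distrib algebra_simps)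
    also have "\<dots> < d" using N N0 assms(2) by (simp add: field_simps)
    finally show ?thesis .
  qed
  ultimately show ?thesis using N0 by (intro that[of s N]) (auto simp: s_def)
qed

text \<open>Used with \<open>g\<close> a small multiple of the variation, this makes \<open>\<Phi>\<close> vanish as soon as its short
  increments are negligible with respect to those of the variation.\<close>

lemma telescoping_bound:
  fixes \<Phi> :: "real \<Rightarrow> 'a::real_normed_vector" and g :: "real \<Rightarrow> real"
  assumes "t \<ge> 0" "d > 0"
    and local: "\<And>a b. \<lbrakk>0 \<le> a; a \<le> b; b \<le> t; b - a < d\<rbrakk> \<Longrightarrow> norm (\<Phi> b - \<Phi> a) \<le> g b - g a"
  shows "norm (\<Phi> t - \<Phi> 0) \<le> g t - g 0"
proof -
  obtain N :: nat and s where s: "mono s" "s 0 = 0" "s N = t" "\<And>j. s (Suc j) - s j < d"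
    using fine_partition[OF assms(1,2)] by blast
  have "norm (\<Phi> (s N) - \<Phi> (s 0)) = norm (\<Sum>j<N. \<Phi> (s (Suc j)) - \<Phi> (s j))"
    by (subst sum_lessThan_telescope[of "\<lambda>j. \<Phi> (s j)"]) simp
  also have "\<dots> \<le> (\<Sum>j<N. g (s (Suc j)) - g (s j))"
  proof (intro order_trans[OF norm_sum] sum_mono local s(4))
    fix j assume "j \<in> {..<N}"
    then show "0 \<le> s j" "s j \<le> s (Suc j)" "s (Suc j) \<le> t"
      using monoD[OF s(1), of 0 j] monoD[OF s(1), of j "Suc j"] monoD[OF s(1), of "Suc j" N] s(2,3)
      by auto
  qed
  also have "\<dots> = g (s N) - g (s 0)" by (rule sum_lessThan_telescope[of "\<lambda>j. g (s j)"])
  finally show ?thesis by (simp add: s)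
qed

lemma pointwise_bounded_convergent_subsequence:
  fixes F :: "nat \<Rightarrow> 'a \<Rightarrow> 'b::{real_normed_vector, heine_borel}"
  assumes "countable S" and "\<And>x. x \<in> S \<Longrightarrow> Bseq (\<lambda>m. F m x)"
  obtains r where "strict_mono r" "\<And>x. x \<in> S \<Longrightarrow> convergent (\<lambda>m. F (r m) x)"
proof -
  have "\<exists>K. \<forall>x\<in>S. K x > 0 \<and> (\<forall>m. norm (F m x) \<le> K x)"
    using assms(2) unfolding Bseq_def by metis
  then obtain K where K: "\<And>x. x \<in> S \<Longrightarrow> K x > 0" "\<And>x m. x \<in> S \<Longrightarrow> norm (F m x) \<le> K x" by blast
  \<comment> \<open>Rescaling each coordinate reduces to a bound that is uniform in \<open>x\<close>.\<close>
  define G where "G m x = F m x /\<^sub>R K x" for m x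
  have "norm (G m x) \<le> 1" if "x \<in> S" for m x
    using K(1)[OF that] K(2)[OF that, of m] by (simp add: G_def field_simps)
  then obtain r where r: "strict_mono r" "\<And>x. x \<in> S \<Longrightarrow> \<exists>L. (\<lambda>m. G (r m) x) \<longlonglongrightarrow> L"
    using function_convergent_subsequence[OF assms(1), of G 1] by blast
  have "convergent (\<lambda>m. F (r m) x)" if x: "x \<in> S" for x
  proof -
    obtain L where "(\<lambda>m. G (r m) x) \<longlonglongrightarrow> L" using r(2)[OF x] by blast
    then have "(\<lambda>m. K x *\<^sub>R G (r m) x) \<longlonglongrightarrow> K x *\<^sub>R L" by (intro tendsto_intros)
    then show ?thesis using K(1)[OF x] by (auto simp: G_def convergent_def)
  qed
  with r(1) show ?thesis by (rule that)
qed

text \<open>The functions may jump, as the step functions of the schemes do: equicontinuity is only required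
  for large \<open>m\<close>, with a threshold that depends on \<open>T\<close> and \<open>e\<close>.  Since all functions start at \<open>0\<close>, pointwise
  boundedness comes for free by chaining short intervals.\<close>

lemma asymptotic_Arzela_Ascoli:
  fixes F :: "nat \<Rightarrow> real \<Rightarrow> 'b::{real_normed_vector, heine_borel}"
  assumes F0: "\<And>m. F m 0 = 0"
    and equi: "\<And>T e. \<lbrakk>T \<ge> 0; e > 0\<rbrakk> \<Longrightarrow>
      \<exists>d>0. \<exists>M. \<forall>m\<ge>M. \<forall>s t. 0 \<le> s \<and> s \<le> t \<and> t \<le> T \<and> t - s < d \<longrightarrow> norm (F m t - F m s) \<le> e"
  obtains r f where "strict_mono (r :: nat \<Rightarrow> nat)" "continuous_on {0..} f"
    "\<And>T. uniform_limit {0..T} (\<lambda>m. F (r m)) f sequentially"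
proof -
  have "Bseq (\<lambda>m. F m t)" if "t \<in> \<rat> \<inter> {0..}" for t
  proof -
    from that have t: "t \<ge> 0" by simp
    obtain d M where d: "d > 0" and M: "\<And>m a b. \<lbrakk>m \<ge> M; 0 \<le> a; a \<le> b; b \<le> t; b - a < d\<rbrakk> \<Longrightarrow> norm (F m b - F m a) \<le> 1"
      using equi[OF t zero_less_one] by blast
    obtain N :: nat where N: "2 * t / d < N" using reals_Archimedean2 by blast
    have chain: "norm (F m (real j * (d/2))) \<le> j" if "m \<ge> M" "real j * (d/2) \<le> t" for m j
      using that
    proof (induction j)
      case (Suc j)
      have "norm (F m (real (Suc j) * (d/2)) - F m (real j * (d/2))) \<le> 1"
        using Suc.prems d by (intro M) (auto simp: algebra_simps)
      moreover have "norm (F m (real j * (d/2))) \<le> j"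
        using Suc d by (intro Suc.IH) (auto simp: algebra_simps)
      moreover note norm_triangle_ineq[of "F m (real (Suc j) * (d/2)) - F m (real j * (d/2))" "F m (real j * (d/2))"]
      ultimately show ?case by simp
    qed (simp add: F0)
    define j where "j = nat \<lfloor>t / (d/2)\<rfloor>"
    have "real j \<le> t / (d/2)" "t / (d/2) < real j + 1"
      using t d by (auto simp: j_def)
    then have j: "real j * (d/2) \<le> t" "t - real j * (d/2) < d" using d by (auto simp: field_simps)
    have "norm (F m t) \<le> real j + 1" if "m \<ge> M" for m
      using chain[OF that j(1)] M[OF that _ j(1) order_refl j(2)] d
        norm_triangle_ineq[of "F m t - F m (real j * (d/2))" "F m (real j * (d/2))"] by simp
    then have "Bseq (\<lambda>m. F (m + M) t)" by (intro BseqI'[of _ "real j + 1"]) simp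
    then show ?thesis by (rule Bseq_offset)
  qed
  moreover have "countable (\<rat> \<inter> {0::real..})" using countable_rat by (rule countable_Int1)
  ultimately obtain r where r: "strict_mono r"
    "\<And>t. t \<in> \<rat> \<inter> {0..} \<Longrightarrow> convergent (\<lambda>m. F (r m) t)"
    using pointwise_bounded_convergent_subsequence[of "\<rat> \<inter> {0::real..}" F] by metis
  have r_ge: "m \<le> r m" for m using r(1) by (rule strict_mono_imp_increasing)
  define f where "f t = lim (\<lambda>m. F (r m) t)" for t
  have lim: "uniform_limit {0..T} (\<lambda>m. F (r m)) f sequentially" for T
  proof -
    have "uniformly_Cauchy_on {0..T} (\<lambda>m. F (r m))"
      unfolding uniformly_Cauchy_on_def
    proof (intro allI impI)
      fix e :: real assume e: "e > 0"
      define T' where "T' = max T 0"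
      obtain d M where d: "d > 0" and M: "\<And>m a b. \<lbrakk>m \<ge> M; 0 \<le> a; a \<le> b; b \<le> T'; b - a < d\<rbrakk> \<Longrightarrow> norm (F m b - F m a) \<le> e/4"
        using equi[of T' "e/4"] e unfolding T'_def by (metis divide_pos_pos max.cobounded2 zero_less_numeral)
      obtain q where q: "q \<in> \<rat>" "0 < q" "q < d" using Rats_dense_in_real[OF d] by blast
      define J where "J = nat \<lfloor>T' / q\<rfloor>"
      have "\<exists>N. \<forall>m\<ge>N. \<forall>m'\<ge>N. dist (F (r m) (j * q)) (F (r m') (j * q)) < e/4" for j :: nat
      proof -
        have "real j * q \<in> \<rat> \<inter> {0..}" using q by auto
        then have "Cauchy (\<lambda>m. F (r m) (j * q))" using r(2) convergent_Cauchy by blast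
        then show ?thesis using e unfolding Cauchy_def by (meson zero_less_divide_iff zero_less_numeral)
      qed
      then obtain N where N: "dist (F (r m) (j * q)) (F (r m') (j * q)) < e/4"
        if "m \<ge> N j" "m' \<ge> N j" for j m m' :: nat
        by metis
      define N' where "N' = Max (insert M (N ` {..J}))"
      show "\<exists>K. \<forall>t\<in>{0..T}. \<forall>m\<ge>K. \<forall>m'\<ge>K. dist (F (r m) t) (F (r m') t) < e"
      proof (intro exI[of _ N'] ballI allI impI)
        fix t m m' assume t: "t \<in> {0..T}" and m: "m \<ge> N'" "m' \<ge> N'"
        define j where "j = nat \<lfloor>t / q\<rfloor>"
        have "real j \<le> t / q" "t / q < real j + 1" using t q by (auto simp: j_def)
        then have j: "real j * q \<le> t" "t - real j * q < d" "0 \<le> real j * q" using q by (auto simp: field_simps)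
        have "j \<le> J" unfolding j_def J_def using t q
          by (intro nat_mono floor_mono divide_right_mono) (auto simp: T'_def)
        then have "N j \<le> N'" "M \<le> N'" unfolding N'_def by (auto intro!: Max_ge simp del: Max_insert)
        then have "dist (F (r m) (j * q)) (F (r m') (j * q)) < e/4" using m by (intro N) auto
        moreover have "norm (F (r k) t - F (r k) (j * q)) \<le> e/4" if "k \<ge> N'" for k
          using \<open>M \<le> N'\<close> that r_ge[of k] t j by (intro M) (auto simp: T'_def)
        then have "dist (F (r m) t) (F (r m) (j * q)) \<le> e/4" "dist (F (r m') t) (F (r m') (j * q)) \<le> e/4"
          using m by (auto simp: dist_norm)
        ultimately show "dist (F (r m) t) (F (r m') t) < e"
          using dist_triangle[of "F (r m) t" "F (r m') t" "F (r m) (j * q)"]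
            dist_triangle[of "F (r m) (j * q)" "F (r m') t" "F (r m') (j * q)"]
            dist_commute[of "F (r m') t" "F (r m') (j * q)"] e by linarith
      qed
    qed
    then have "uniformly_convergent_on {0..T} (\<lambda>m. F (r m))"
      by (rule Cauchy_uniformly_convergent)
    then show ?thesis unfolding uniformly_convergent_uniform_limit_iff f_def .
  qed
  have pointwise: "(\<lambda>m. F (r m) t) \<longlonglongrightarrow> f t" if "t \<ge> 0" for t
    using tendsto_uniform_limitI[OF lim[of t]] that by simp
  have close: "\<exists>d>0. \<forall>s t. 0 \<le> s \<and> s \<le> t \<and> t \<le> T \<and> t - s < d \<longrightarrow> norm (f t - f s) \<le> e"
    if Te: "T \<ge> 0" "e > 0" for T e
  proof -
    obtain d M where d: "d > 0" and M: "\<And>m a b. \<lbrakk>m \<ge> M; 0 \<le> a; a \<le> b; b \<le> T; b - a < d\<rbrakk> \<Longrightarrow> norm (F m b - F m a) \<le> e"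
      using equi[OF Te] by blast
    have "norm (f t - f s) \<le> e" if st: "0 \<le> s" "s \<le> t" "t \<le> T" "t - s < d" for s t
    proof (rule tendsto_upperbound)
      show "(\<lambda>m. norm (F (r m) t - F (r m) s)) \<longlonglongrightarrow> norm (f t - f s)"
        using st by (intro tendsto_intros pointwise) auto
      show "\<forall>\<^sub>F m in sequentially. norm (F (r m) t - F (r m) s) \<le> e"
        using M st r_ge order_trans by (intro eventually_sequentiallyI[of M]) blast
    qed simp
    with d show ?thesis by blast
  qed
  have "continuous_on {0..} f"
    unfolding continuous_on_iff
  proof (intro ballI allI impI)
    fix t e :: real assume t: "t \<in> {0..}" and e: "e > 0"
    obtain d where d: "d > 0" "\<And>a b. \<lbrakk>0 \<le> a; a \<le> b; b \<le> t + 1; b - a < d\<rbrakk> \<Longrightarrow> norm (f b - f a) \<le> e/2"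
      using close[of "t + 1" "e/2"] t e by auto
    show "\<exists>d>0. \<forall>s\<in>{0..}. dist s t < d \<longrightarrow> dist (f s) (f t) < e"
    proof (intro exI[of _ "min d 1"] conjI ballI impI)
      fix s :: real assume s: "s \<in> {0..}" "dist s t < min d 1"
      have "norm (f s - f t) \<le> e/2"
      proof (cases "s \<le> t")
        case True
        then have "norm (f t - f s) \<le> e/2" using s t by (intro d(2)) (auto simp: dist_real_def)
        then show ?thesis by (simp add: norm_minus_commute)
      next
        case False
        then show ?thesis using s t by (intro d(2)) (auto simp: dist_real_def)
      qed
      then show "dist (f s) (f t) < e" using e by (simp add: dist_norm)
    qed (use d in auto)
  qed
  with r(1) lim show ?thesis using that by blast
qed

section \<open>The Stieltjes representation of the push\<close>

lemma total_variation_le: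
  assumes "\<And>a b. \<lbrakk>a \<in> S; b \<in> S; a \<le> b\<rbrakk> \<Longrightarrow> norm (f b - f a) \<le> g b - g a"
    and "\<And>a b. \<lbrakk>a \<in> S; b \<in> S; a \<le> b\<rbrakk> \<Longrightarrow> g b - g a \<le> K"
  shows "total_variation S f \<le> ennreal K"
  unfolding total_variation_def
proof (rule SUP_least, clarify)
  fix N :: nat and t :: "nat \<Rightarrow> real" assume t: "mono_on {..N} t" "t ` {..N} \<subseteq> S"
  have "(\<Sum>i<N. norm (f (t (Suc i)) - f (t i))) \<le> (\<Sum>i<N. g (t (Suc i)) - g (t i))"
    using t by (intro sum_mono assms(1)) (auto intro: mono_onD)
  also have "\<dots> = g (t N) - g (t 0)" by (rule sum_lessThan_telescope[of "\<lambda>i. g (t i)"])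
  also have "\<dots> \<le> K" using t by (intro assms(2)) (auto intro: mono_onD)
  finally show "(\<Sum>i<N. ennreal (norm (f (t (Suc i)) - f (t i)))) \<le> ennreal K"
    by (simp add: sum_ennreal ennreal_leI)
qed

lemma total_variation_ge:
  assumes "t \<ge> 0" "d > 0"
    and local: "\<And>a b. \<lbrakk>0 \<le> a; a \<le> b; b \<le> t; b - a < d\<rbrakk> \<Longrightarrow> g b - g a \<le> norm (f b - f a)"
  shows "ennreal (g t - g 0) \<le> total_variation {0..t} f"
proof -
  obtain N :: nat and s where s: "mono s" "s 0 = 0" "s N = t" "\<And>j. s (Suc j) - s j < d"
    using fine_partition[OF assms(1,2)] by blast
  have s_in: "s j \<in> {0..t}" if "j \<le> N" for j
    using monoD[OF s(1), of 0 j] monoD[OF s(1) that] s(2,3) by simp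
  have "g (s N) - g (s 0) = (\<Sum>j<N. g (s (Suc j)) - g (s j))"
    by (rule sum_lessThan_telescope[of "\<lambda>j. g (s j)", symmetric])
  also have "\<dots> \<le> (\<Sum>j<N. norm (f (s (Suc j)) - f (s j)))"
  proof (intro sum_mono local s(4))
    fix j assume "j \<in> {..<N}"
    then show "0 \<le> s j" "s j \<le> s (Suc j)" "s (Suc j) \<le> t"
      using s_in[of j] s_in[of "Suc j"] monoD[OF s(1), of j "Suc j"] by auto
  qed
  finally have "ennreal (g t - g 0) \<le> (\<Sum>j<N. ennreal (norm (f (s (Suc j)) - f (s j))))"
    by (simp add: s sum_ennreal ennreal_leI)
  also have "\<dots> \<le> total_variation {0..t} f"
    unfolding total_variation_def
    by (rule SUP_upper2[of "(N, s)"])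
      (use s_in in \<open>auto intro: mono_on_subset[OF s(1)]\<close>)
  finally show ?thesis .
qed

lemma total_variation_mono: "S \<subseteq> S' \<Longrightarrow> total_variation S f \<le> total_variation S' f"
  unfolding total_variation_def by (rule SUP_subset_mono) auto

text \<open>The properties that survive in the limit of the schemes.  The function \<open>l\<close> turns out to be the
  variation of \<open>L\<close>; \<open>L_increment_normal\<close> is the integral-free form of \<open>dL = n(x) dl\<close>.\<close>

locale reflected_path = reflecting_domain D n C\<^sub>0
  for D :: "'a::euclidean_space set" and n :: "'a \<Rightarrow> 'a" and C\<^sub>0 :: real +
  fixes x L :: "real \<Rightarrow> 'a" and l :: "real \<Rightarrow> real"
  assumes x_cont: "continuous_on {0..} x" and x_closure: "t \<ge> 0 \<Longrightarrow> x t \<in> closure D"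
    and L_cont: "continuous_on {0..} L" and l_cont: "continuous_on {0..} l"
    and L0: "L 0 = 0" and l0: "l 0 = 0"
    and L_increment_le: "\<lbrakk>0 \<le> s; s \<le> t\<rbrakk> \<Longrightarrow> norm (L t - L s) \<le> l t - l s"
    and l_inside: "\<lbrakk>0 \<le> s; s \<le> t; \<And>u. \<lbrakk>s \<le> u; u \<le> t\<rbrakk> \<Longrightarrow> x u \<notin> frontier D\<rbrakk> \<Longrightarrow> l t = l s"
    and L_increment_normal: "\<lbrakk>T \<ge> 0; e > 0\<rbrakk> \<Longrightarrow> \<exists>d>0. \<forall>s r t. 0 \<le> s \<and> s \<le> r \<and> r \<le> t \<and> t \<le> T \<and> t - s < d \<and>
      x r \<in> frontier D \<longrightarrow> norm (L t - L s - (l t - l s) *\<^sub>R n (x r)) \<le> e * (l t - l s)"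
begin

lemma l_mono: "\<lbrakk>0 \<le> s; s \<le> t\<rbrakk> \<Longrightarrow> l s \<le> l t"
  using L_increment_le[of s t] norm_ge_zero[of "L t - L s"] by linarith

text \<open>On a short interval that meets the boundary, \<open>L\<close> moves by nearly \<open>l b - l a\<close> times a unit vector,
  so its variation is at least \<open>(1 - e) (l b - l a)\<close>; on the other intervals \<open>l\<close> is constant.\<close>

lemma total_variation_L:
  assumes "t \<ge> 0"
  shows "total_variation {0..t} L = ennreal (l t)"
proof (rule antisym)
  show "total_variation {0..t} L \<le> ennreal (l t)"
    using l_mono l0 by (intro total_variation_le[of _ _ l] L_increment_le) (auto, smt (verit))
  have "ennreal ((1 - e) * l t) \<le> total_variation {0..t} L" if e: "0 < e" "e < 1" for e
  proof -
    obtain d where d: "d > 0" "\<And>a r b. \<lbrakk>0 \<le> a; a \<le> r; r \<le> b; b \<le> t; b - a < d; x r \<in> frontier D\<rbrakk>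
        \<Longrightarrow> norm (L b - L a - (l b - l a) *\<^sub>R n (x r)) \<le> e * (l b - l a)"
      using L_increment_normal[OF assms e(1)] by blast
    have "(1 - e) * l b - (1 - e) * l a \<le> norm (L b - L a)"
      if ab: "0 \<le> a" "a \<le> b" "b \<le> t" "b - a < d" for a b
    proof (cases "\<exists>r. a \<le> r \<and> r \<le> b \<and> x r \<in> frontier D")
      case True
      then obtain r where r: "a \<le> r" "r \<le> b" "x r \<in> frontier D" by blast
      have "norm ((l b - l a) *\<^sub>R n (x r)) = l b - l a"
        using l_mono[OF ab(1,2)] norm_normal[OF r(3)] by simp
      moreover have "norm ((l b - l a) *\<^sub>R n (x r)) - norm (L b - L a)
          \<le> norm (L b - L a - (l b - l a) *\<^sub>R n (x r))"
        by (metis norm_minus_commute norm_triangle_ineq2)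
      moreover have "norm (L b - L a - (l b - l a) *\<^sub>R n (x r)) \<le> e * (l b - l a)"
        using ab r by (intro d(2)) auto
      ultimately show ?thesis by (simp add: algebra_simps)
    next
      case False
      then have "l b = l a" using ab by (intro l_inside) auto
      then show ?thesis by simp
    qed
    from total_variation_ge[OF assms d(1), of "\<lambda>t. (1 - e) * l t" L, OF this] show ?thesis
      by (simp add: l0)
  qed
  note lower = this
  show "ennreal (l t) \<le> total_variation {0..t} L"
  proof (rule tendsto_upperbound)
    have "((\<lambda>e. ennreal ((1 - e) * l t)) \<longlongrightarrow> ennreal ((1 - 0) * l t)) (at_right 0)"
      by (intro tendsto_intros)
    then show "((\<lambda>e. ennreal ((1 - e) * l t)) \<longlongrightarrow> ennreal (l t)) (at_right 0)" by simp
    show "\<forall>\<^sub>F e in at_right 0. ennreal ((1 - e) * l t) \<le> total_variation {0..t} L"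
      using lower by (auto simp: eventually_at_right_field intro!: exI[of _ 1])
  qed simp
qed

lemma bounded_variation_L: "bounded_variation_on {0<..<T} L"
proof (cases "T \<ge> 0")
  case True
  have "total_variation {0<..<T} L \<le> total_variation {0..T} L"
    by (rule total_variation_mono) auto
  then show ?thesis
    unfolding bounded_variation_on_def total_variation_L[OF True] infinity_ennreal_def
    by (rule order_le_less_trans) simp
next
  case False
  have "total_variation {0<..<T} L \<le> ennreal 0"
    by (rule total_variation_le[where g = "\<lambda>_. 0"]) (use False in auto)
  then show ?thesis unfolding bounded_variation_on_def by simp
qed

lemma variation_upto_L: "variation_upto L = (\<lambda>t. l (max 0 t))"
proof
  fix t :: real
  show "variation_upto L t = l (max 0 t)"
  proof (cases "t \<ge> 0")
    case True
    then show ?thesis using total_variation_L[OF True] l_mono[of 0 t] l0 by (simp add: variation_upto_def)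
  next
    case False
    have "total_variation {0..t} L \<le> ennreal 0"
      by (rule total_variation_le[where g = "\<lambda>_. 0"]) (use False in auto)
    then show ?thesis using False l0 by (simp add: variation_upto_def)
  qed
qed

abbreviation \<mu> :: "real measure" where "\<mu> \<equiv> variation_measure L"

lemma sets_\<mu>: "sets \<mu> = sets borel"
  by (simp add: variation_measure_def)

lemma emeasure_\<mu>_Icc:
  assumes "a \<le> b"
  shows "emeasure \<mu> {a..b} = ennreal (l (max 0 b) - l (max 0 a))"
proof -
  have "continuous_on UNIV (\<lambda>t. l (max 0 t))"
    by (rule continuous_on_compose2[OF l_cont]) (auto intro!: continuous_intros)
  then show ?thesis
    unfolding variation_measure_def variation_upto_L using assms l_mono
    by (intro emeasure_interval_measure_Icc) (auto simp: max_def)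
qed

lemma emeasure_\<mu>_Ioc:
  assumes "0 \<le> a" "a \<le> b"
  shows "emeasure \<mu> {a<..b} = ennreal (l b - l a)"
proof -
  have "continuous_on UNIV (\<lambda>t. l (max 0 t))"
    by (rule continuous_on_compose2[OF l_cont]) (auto intro!: continuous_intros)
  then have "continuous (at_right c) (\<lambda>t. l (max 0 t))" for c
    by (simp add: continuous_on_eq_continuous_within continuous_at_imp_continuous_at_within)
  then have "emeasure \<mu> {a<..b} = ennreal (l (max 0 b) - l (max 0 a))"
    unfolding variation_measure_def variation_upto_L using assms l_mono
    by (intro emeasure_interval_measure_Ioc) (auto simp: max_def)
  then show ?thesis using assms by (simp add: max_absorb2)
qed

definition contact :: "real set" where "contact = {s. 0 \<le> s \<and> x s \<in> frontier D}"

lemma closed_contact: "closed contact"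
proof -
  have "closed ({0..} \<inter> x -` frontier D)"
    by (intro continuous_closed_preimage[OF x_cont]) auto
  moreover have "contact = {0..} \<inter> x -` frontier D" by (auto simp: contact_def)
  ultimately show ?thesis by simp
qed

text \<open>The times spent in the interior form an open set, hence a countable union of compact intervals,
  on each of which \<open>l\<close> is constant.  Extending \<open>x\<close> by \<open>x 0\<close> to negative times turns relatively open
  sets of times into open ones.\<close>

lemma AE_contact: "AE s in \<mu>. 0 \<le> s \<longrightarrow> s \<in> contact"
proof -
  define U where "U = {s. x (max 0 s) \<in> D}"
  have "continuous_on UNIV (\<lambda>s. x (max 0 s))"
    by (rule continuous_on_compose2[OF x_cont]) (auto intro!: continuous_intros)
  then have "open U"
    unfolding U_def using open_D by (simp add: continuous_on_open_vimage vimage_def)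
  then obtain \<I> where \<I>: "countable \<I>" "\<And>I. I \<in> \<I> \<Longrightarrow> I \<subseteq> U" "\<And>I. I \<in> \<I> \<Longrightarrow> \<exists>a b. I = cbox a b" "\<Union>\<I> = U"
    by (rule open_countable_Union_open_cbox) blast
  have "I \<in> null_sets \<mu>" if I_in: "I \<in> \<I>" for I
  proof -
    obtain a b where "I = cbox a b" using \<I>(3)[OF I_in] by blast
    then have I: "I = {a..b}" by simp
    have "emeasure \<mu> {a..b} = 0"
    proof (cases "a \<le> b")
      case True
      have "l (max 0 b) = l (max 0 a)"
      proof (rule l_inside)
        fix u assume u: "max 0 a \<le> u" "u \<le> max 0 b"
        have "u \<in> {a..b} \<or> u = max 0 b" using u True by auto
        then have "x u \<in> D"
        proof
          assume "u \<in> {a..b}"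
          then have "u \<in> U" using \<I>(2)[OF that] I by auto
          moreover have "max 0 u = u" using u by simp
          ultimately show ?thesis by (simp add: U_def)
        next
          assume "u = max 0 b"
          moreover have "b \<in> U" using \<I>(2)[OF that] I True by auto
          ultimately show ?thesis by (simp add: U_def)
        qed
        then show "x u \<notin> frontier D" using open_D by (simp add: frontier_def interior_open)
      qed (use True in auto)
      then show ?thesis using emeasure_\<mu>_Icc[OF True] by simp
    qed simp
    then show ?thesis using I by (auto simp: null_sets_def sets_\<mu>)
  qed
  then have "U \<in> null_sets \<mu>"
    using \<I>(1) unfolding \<I>(4)[symmetric] using null_sets_UN'[of \<I> "\<lambda>I. I" \<mu>] by simp
  then show ?thesis
  proof (rule AE_I')
    show "{s \<in> space \<mu>. \<not> (0 \<le> s \<longrightarrow> s \<in> contact)} \<subseteq> U"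
      using closure_cases x_closure by (auto simp: U_def contact_def max_def)
  qed
qed

lemma emeasure_contact_inter:
  assumes "E \<in> sets borel" "E \<subseteq> {0..}"
  shows "emeasure \<mu> (contact \<inter> E) = emeasure \<mu> E"
proof (rule emeasure_eq_AE)
  show "AE s in \<mu>. (s \<in> contact \<inter> E) = (s \<in> E)"
    using AE_contact by (rule eventually_mono) (use assms in auto)
qed (use assms closed_contact in \<open>auto simp: sets_\<mu>\<close>)

lemma set_integrable_contact:
  assumes "E \<in> sets borel" "E \<subseteq> {0..t}"
  shows "set_integrable \<mu> (contact \<inter> E) (\<lambda>s. n (x s))"
  unfolding set_integrable_def
proof (rule integrableI_bounded_set[where A = "contact \<inter> E" and B = 1])
  have cE: "contact \<inter> E \<in> sets borel" using assms closed_contact by auto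
  then show "contact \<inter> E \<in> sets \<mu>" by (simp add: sets_\<mu>)
  have "continuous_on (contact \<inter> E) (\<lambda>s. n (x s))"
    by (rule continuous_on_compose2[OF continuous_normal continuous_on_subset[OF x_cont]])
      (auto simp: contact_def)
  then have "(\<lambda>s. indicator (contact \<inter> E) s *\<^sub>R n (x s)) \<in> borel_measurable borel"
    by (rule borel_measurable_continuous_on_indicator[OF cE])
  then show "(\<lambda>s. indicator (contact \<inter> E) s *\<^sub>R n (x s)) \<in> borel_measurable \<mu>"
    using measurable_cong_sets[OF sets_\<mu> refl] by blast
  have "emeasure \<mu> (contact \<inter> E) \<le> emeasure \<mu> {0..max 0 t}"
    using assms by (intro emeasure_mono) (auto simp: sets_\<mu>)
  also have "\<dots> < \<infinity>" using emeasure_\<mu>_Icc[of 0 "max 0 t"] by simp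
  finally show "emeasure \<mu> (contact \<inter> E) < \<infinity>" .
qed (auto simp: contact_def norm_normal)

definition push :: "real \<Rightarrow> 'a" where "push t = (LINT s:contact \<inter> {0..t}|\<mu>. n (x s))"

lemma push_increment:
  assumes "0 \<le> a" "a \<le> b"
  shows "push b - push a = (LINT s:contact \<inter> {a<..b}|\<mu>. n (x s))"
proof -
  have "push b = (LINT s:(contact \<inter> {0..a}) \<union> (contact \<inter> {a<..b})|\<mu>. n (x s))"
    unfolding push_def using assms by (intro arg_cong2[where f = "\<lambda>E f. set_lebesgue_integral \<mu> E f"]) auto
  also have "\<dots> = push a + (LINT s:contact \<inter> {a<..b}|\<mu>. n (x s))"
    unfolding push_def using assms
    by (intro set_integral_Un set_integrable_contact[where t = b]) auto
  finally show ?thesis by simp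
qed

lemma push_increment_close:
  assumes ab: "0 \<le> a" "a \<le> b"
    and close: "\<And>s. \<lbrakk>s \<in> contact; a < s; s \<le> b\<rbrakk> \<Longrightarrow> norm (n (x s) - c) \<le> e"
  shows "norm (push b - push a - (l b - l a) *\<^sub>R c) \<le> e * (l b - l a)"
proof -
  let ?E = "contact \<inter> {a<..b}"
  have Eb: "?E \<in> sets \<mu>" using closed_contact by (auto simp: sets_\<mu>)
  have em: "emeasure \<mu> ?E = ennreal (l b - l a)"
    using ab by (subst emeasure_contact_inter) (auto simp: emeasure_\<mu>_Ioc)
  then have me: "measure \<mu> ?E = l b - l a" using l_mono[OF ab] by (simp add: measure_def)
  have int_n: "set_integrable \<mu> ?E (\<lambda>s. n (x s))"
    using ab by (intro set_integrable_contact[where t = b]) auto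
  have const: "set_integrable \<mu> ?E (\<lambda>_. k)" for k :: "'b::{banach, second_countable_topology}"
    unfolding set_integrable_def using Eb em by (intro integrableI_bounded_set_indicator[where B = "norm k"]) auto
  have lint_const: "(LINT s:?E|\<mu>. k) = (l b - l a) *\<^sub>R k" for k :: "'b::{banach, second_countable_topology}"
    using Eb em me by (simp add: set_lebesgue_integral_def)
  have "push b - push a - (l b - l a) *\<^sub>R c = (LINT s:?E|\<mu>. n (x s) - c)"
    unfolding push_increment[OF ab] lint_const[of c, symmetric]
    by (rule set_integral_diff(2)[OF int_n const, symmetric])
  also have "norm \<dots> \<le> (LINT s:?E|\<mu>. norm (n (x s) - c))"
    by (rule set_integral_norm_bound) (rule set_integral_diff(1)[OF int_n const])
  also have "\<dots> \<le> (LINT s:?E|\<mu>. e)"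
    by (rule set_integral_mono[OF set_integrable_norm[OF set_integral_diff(1)[OF int_n const]] const])
      (use close in auto)
  also have "\<dots> = e * (l b - l a)" by (simp add: lint_const)
  finally show ?thesis .
qed

text \<open>Both sides have the same increments up to \<open>2 e\<close> times those of \<open>l\<close> on short intervals: each is
  close to \<open>(l b - l a) n (x r)\<close> if \<open>x r\<close> is on the boundary for some \<open>r\<close> in the interval, and both are
  constant otherwise.\<close>

lemma push_eq_L:
  assumes t: "t \<ge> 0"
  shows "push t = L t"
proof -
  have push0: "push 0 = 0"
  proof -
    have "AE s in \<mu>. s \<notin> contact \<inter> {0..0}"
    proof (rule AE_I')
      show "{0} \<in> null_sets \<mu>" using emeasure_\<mu>_Icc[of 0 0] by (auto simp: sets_\<mu>)
    qed auto
    then have "AE s in \<mu>. indicator (contact \<inter> {0..0}) s *\<^sub>R n (x s) = 0"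
      by (rule eventually_mono) (auto simp: indicator_def)
    then show ?thesis
      unfolding push_def set_lebesgue_integral_def by (rule integral_eq_zero_AE)
  qed
  have bound: "norm (push t - L t) \<le> 2 * e * l t" if e: "e > 0" for e
  proof -
    obtain d1 where d1: "d1 > 0" "\<And>a r b. \<lbrakk>0 \<le> a; a \<le> r; r \<le> b; b \<le> t; b - a < d1; x r \<in> frontier D\<rbrakk>
        \<Longrightarrow> norm (L b - L a - (l b - l a) *\<^sub>R n (x r)) \<le> e * (l b - l a)"
      using L_increment_normal[OF t e] by blast
    have "continuous_on (contact \<inter> {0..t}) (\<lambda>s. n (x s))"
      by (rule continuous_on_compose2[OF continuous_normal continuous_on_subset[OF x_cont]])
        (auto simp: contact_def)
    moreover have "compact (contact \<inter> {0..t})" using closed_contact by (intro closed_Int_compact) auto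
    ultimately have "uniformly_continuous_on (contact \<inter> {0..t}) (\<lambda>s. n (x s))"
      by (rule compact_uniformly_continuous)
    then obtain d2 where d2: "d2 > 0" "\<And>r s. \<lbrakk>r \<in> contact \<inter> {0..t}; s \<in> contact \<inter> {0..t}; dist s r < d2\<rbrakk>
        \<Longrightarrow> dist (n (x s)) (n (x r)) < e"
      unfolding uniformly_continuous_on_def using e by metis
    have increment: "norm ((push b - L b) - (push a - L a)) \<le> 2 * e * l b - 2 * e * l a"
      if ab: "0 \<le> a" "a \<le> b" "b \<le> t" "b - a < min d1 d2" for a b
    proof (cases "\<exists>r. a \<le> r \<and> r \<le> b \<and> x r \<in> frontier D")
      case True
      then obtain r where r: "a \<le> r" "r \<le> b" "x r \<in> frontier D" by blast
      have "norm (n (x s) - n (x r)) \<le> e" if "s \<in> contact" "a < s" "s \<le> b" for s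
        using d2(2)[of r s] that r ab by (force simp: dist_norm contact_def)
      then have "norm (push b - push a - (l b - l a) *\<^sub>R n (x r)) \<le> e * (l b - l a)"
        using ab by (intro push_increment_close) auto
      moreover have "norm (L b - L a - (l b - l a) *\<^sub>R n (x r)) \<le> e * (l b - l a)"
        using ab r by (intro d1(2)) auto
      ultimately have "norm ((push b - push a - (l b - l a) *\<^sub>R n (x r)) - (L b - L a - (l b - l a) *\<^sub>R n (x r)))
          \<le> e * (l b - l a) + e * (l b - l a)"
        by (rule order_trans[OF norm_triangle_ineq4 add_mono])
      moreover have "(push b - push a - (l b - l a) *\<^sub>R n (x r)) - (L b - L a - (l b - l a) *\<^sub>R n (x r))
        = (push b - L b) - (push a - L a)" by simp
      ultimately have "norm ((push b - L b) - (push a - L a)) \<le> e * (l b - l a) + e * (l b - l a)" by simp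
      then show ?thesis by (simp add: algebra_simps)
    next
      case False
      then have ll: "l b = l a" using ab by (intro l_inside) auto
      have "contact \<inter> {a<..b} = {}" using False by (auto simp: contact_def)
      then have "push b = push a" using push_increment[OF ab(1,2)] by (simp add: set_lebesgue_integral_def)
      moreover have "L b = L a" using L_increment_le[OF ab(1,2)] ll by simp
      ultimately show ?thesis using ll by simp
    qed
    have "norm ((push t - L t) - (push 0 - L 0)) \<le> 2 * e * l t - 2 * e * l 0"
      by (rule telescoping_bound[where d = "min d1 d2" and \<Phi> = "\<lambda>s. push s - L s" and g = "\<lambda>s. 2 * e * l s"])
        (use t d1(1) d2(1) increment in auto)
    then show ?thesis by (simp add: push0 L0 l0)
  qed
  have "norm (push t - L t) \<le> 0"
  proof (rule tendsto_lowerbound)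
    have "((\<lambda>e. 2 * e * l t) \<longlongrightarrow> 2 * 0 * l t) (at_right 0)" by (intro tendsto_intros)
    then show "((\<lambda>e. 2 * e * l t) \<longlongrightarrow> 0) (at_right 0)" by simp
    show "\<forall>\<^sub>F e in at_right 0. norm (push t - L t) \<le> 2 * e * l t"
      using bound by (auto simp: eventually_at_right_field intro!: exI[of _ 1])
  qed simp
  then show ?thesis by simp
qed

theorem solves_extended_skorohod:
  assumes "\<And>t. t \<ge> 0 \<Longrightarrow> x t = w t + integral {0..t} L + L t"
  shows "extended_skorohod_solution w D n x L"
proof -
  have contact_eq: "{s \<in> {0..t}. x s \<in> frontier D} = contact \<inter> {0..t}" for t
    by (auto simp: contact_def)
  have "variation_upto L t = (LINT s:{0..t}|\<mu>. indicator {s. x s \<in> frontier D} s)" if t: "t \<ge> 0" for t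
  proof -
    have "(LINT s:{0..t}|\<mu>. indicator {s. x s \<in> frontier D} s :: real)
        = (LINT s|\<mu>. indicator (contact \<inter> {0..t}) s)"
      unfolding set_lebesgue_integral_def
      by (intro Bochner_Integration.integral_cong) (auto simp: contact_def indicator_def)
    also have "\<dots> = measure \<mu> (contact \<inter> {0..t})"
      using closed_contact by (simp add: variation_measure_def)
    also have "\<dots> = l t"
      using emeasure_contact_inter[of "{0..t}"] emeasure_\<mu>_Icc[OF t] t l_mono[of 0 t] l0
      by (simp add: measure_def)
    finally show ?thesis using t by (simp add: variation_upto_L)
  qed
  moreover have "set_integrable \<mu> {s \<in> {0..t}. x s \<in> frontier D} (\<lambda>s. n (x s)) \<and>
      L t = (LINT s:{s \<in> {0..t}. x s \<in> frontier D}|\<mu>. n (x s))" if t: "t \<ge> 0" for t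
    unfolding contact_eq using push_eq_L[OF t] set_integrable_contact[of "{0..t}" t]
    by (simp add: push_def)
  ultimately show ?thesis
    unfolding extended_skorohod_solution_def
    using x_cont x_closure L_cont bounded_variation_L assms by blast
qed

end

section \<open>Passage to the limit\<close>

definition grid_index :: "real \<Rightarrow> real \<Rightarrow> nat" where
  "grid_index h t = nat \<lfloor>t / h\<rfloor>"

lemma grid_index_0 [simp]: "grid_index h 0 = 0"
  by (simp add: grid_index_def)

lemma grid_index_bounds:
  assumes "h > 0" "t \<ge> 0"
  shows "h * grid_index h t \<le> t" "t < h * grid_index h t + h"
proof -
  have "real (grid_index h t) \<le> t / h" "t / h < real (grid_index h t) + 1"
    using assms by (auto simp: grid_index_def)
  then show "h * grid_index h t \<le> t" "t < h * grid_index h t + h"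
    using assms by (auto simp: field_simps)
qed

lemma grid_index_mono: "\<lbrakk>h > 0; s \<le> t\<rbrakk> \<Longrightarrow> grid_index h s \<le> grid_index h t"
  unfolding grid_index_def by (intro nat_mono floor_mono divide_right_mono) auto

text \<open>Every value of a scheme between two indices is a value of its step function between the two
  times, so uniform convergence of step functions controls all intermediate values.\<close>

lemma grid_index_surj:
  assumes "h > 0" "0 \<le> s" "s \<le> t" "grid_index h s \<le> j" "j \<le> grid_index h t"
  obtains u where "s \<le> u" "u \<le> t" "grid_index h u = j"
proof (cases "j = grid_index h s")
  case True
  then show ?thesis using that[of s] assms by auto
next
  case False
  then have "real (grid_index h s) + 1 \<le> real j" using assms by linarith
  then have "h * (real (grid_index h s) + 1) \<le> h * j" using assms by (intro mult_left_mono) auto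
  then have "s \<le> h * j" using grid_index_bounds(2)[of h s] assms by (simp add: algebra_simps)
  moreover have "h * j \<le> h * grid_index h t" using assms by (intro mult_left_mono) auto
  then have "h * j \<le> t" using grid_index_bounds(1)[of h t] assms by linarith
  moreover have "grid_index h (h * j) = j" using assms by (simp add: grid_index_def)
  ultimately show ?thesis by (rule that)
qed

locale euler_limit = reflecting_domain D n C\<^sub>0
  for D :: "'a::euclidean_space set" and n :: "'a \<Rightarrow> 'a" and C\<^sub>0 :: real +
  fixes w :: "real \<Rightarrow> 'a" and h :: "nat \<Rightarrow> real" and X Y A :: "nat \<Rightarrow> nat \<Rightarrow> 'a" and l :: "nat \<Rightarrow> nat \<Rightarrow> real"
    and L a :: "real \<Rightarrow> 'a" and v :: "real \<Rightarrow> real"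
  assumes scheme: "projected_euler D n C\<^sub>0 w (h m) (X m) (Y m) (A m) (l m)"
    and h_lim: "h \<longlonglongrightarrow> 0"
    and w_cont: "continuous_on {0..} w" and L_cont: "continuous_on {0..} L"
    and a_cont: "continuous_on {0..} a" and v_cont: "continuous_on {0..} v"
    and Y_lim: "uniform_limit {0..T} (\<lambda>m t. Y m (grid_index (h m) t)) L sequentially"
    and A_lim: "uniform_limit {0..T} (\<lambda>m t. A m (grid_index (h m) t)) a sequentially"
    and l_lim: "uniform_limit {0..T} (\<lambda>m t. l m (grid_index (h m) t)) v sequentially"
begin

lemma h_pos: "h m > 0"
  using scheme projected_euler.h by blast

definition x :: "real \<Rightarrow> 'a" where "x t = w t + a t + L t"

lemma x_cont: "continuous_on {0..} x"
  unfolding x_def by (intro continuous_intros w_cont a_cont L_cont)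

lemma grid_time_lim:
  assumes "t \<ge> 0"
  shows "(\<lambda>m. h m * grid_index (h m) t) \<longlonglongrightarrow> t"
proof (rule tendsto_sandwich)
  show "(\<lambda>m. t - h m) \<longlonglongrightarrow> t" using tendsto_diff[OF tendsto_const h_lim, of t] by simp
  show "(\<lambda>m. t) \<longlonglongrightarrow> t" by simp
qed (use grid_index_bounds[OF h_pos assms] in \<open>auto intro!: always_eventually less_imp_le simp: algebra_simps\<close>)

lemma w_lim: "uniform_limit {0..T} (\<lambda>m t. w (h m * grid_index (h m) t)) w sequentially"
  unfolding uniform_limit_iff
proof (intro allI impI)
  fix e :: real assume e: "e > 0"
  have "uniformly_continuous_on {0..T} w"
    by (rule compact_uniformly_continuous[OF continuous_on_subset[OF w_cont]]) auto
  then obtain d where d: "d > 0" "\<And>s t. \<lbrakk>s \<in> {0..T}; t \<in> {0..T}; dist t s < d\<rbrakk> \<Longrightarrow> dist (w t) (w s) < e"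
    unfolding uniformly_continuous_on_def using e by metis
  have "\<forall>\<^sub>F m in sequentially. h m < d" using h_lim d(1) by (rule order_tendstoD)
  then show "\<forall>\<^sub>F m in sequentially. \<forall>t\<in>{0..T}. dist (w (h m * grid_index (h m) t)) (w t) < e"
  proof (rule eventually_mono, intro ballI)
    fix m t assume m: "h m < d" and t: "t \<in> {0..T}"
    have "0 \<le> h m * grid_index (h m) t" using h_pos[of m] by simp
    moreover have "0 \<le> t" using t by simp
    note grid_index_bounds[OF h_pos this, of m]
    ultimately show "dist (w (h m * grid_index (h m) t)) (w t) < e"
      using t m by (intro d(2)) (auto simp: dist_real_def)
  qed
qed

lemma X_lim: "uniform_limit {0..T} (\<lambda>m t. X m (grid_index (h m) t)) x sequentially"
proof -
  have "X m k = w (h m * k) + A m k + Y m k" for m k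
    using scheme by (rule projected_euler.X_eq)
  then show ?thesis
    unfolding x_def by (simp, intro uniform_limit_add w_lim A_lim Y_lim)
qed

lemma pointwise:
  assumes "t \<ge> 0"
  shows "(\<lambda>m. X m (grid_index (h m) t)) \<longlonglongrightarrow> x t" "(\<lambda>m. Y m (grid_index (h m) t)) \<longlonglongrightarrow> L t"
    "(\<lambda>m. A m (grid_index (h m) t)) \<longlonglongrightarrow> a t" "(\<lambda>m. l m (grid_index (h m) t)) \<longlonglongrightarrow> v t"
  using tendsto_uniform_limitI[OF X_lim[of t]] tendsto_uniform_limitI[OF Y_lim[of t]]
    tendsto_uniform_limitI[OF A_lim[of t]] tendsto_uniform_limitI[OF l_lim[of t]] assms by simp_all

text \<open>The Riemann sums \<open>A\<close> are compared with their limit through increments only, so that \<open>a\<close> is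
  recognised as an antiderivative of \<open>L\<close>.  The gap between \<open>e\<close> and \<open>e'\<close> absorbs the distance of \<open>Y\<close>
  to its limit.\<close>

lemma a_increment_close:
  assumes st: "0 \<le> s" "s \<le> t" and e: "e < e'"
    and close: "\<And>u. \<lbrakk>s \<le> u; u \<le> t\<rbrakk> \<Longrightarrow> norm (L u - c) \<le> e"
  shows "norm (a t - a s - (t - s) *\<^sub>R c) \<le> e' * (t - s)"
proof (rule tendsto_le)
  let ?i = "\<lambda>m. grid_index (h m) s" and ?k = "\<lambda>m. grid_index (h m) t"
  have times: "(\<lambda>m. h m * (real (?k m) - real (?i m))) \<longlonglongrightarrow> t - s"
    using tendsto_diff[OF grid_time_lim[of t] grid_time_lim[of s]] st by (simp add: right_diff_distrib)
  show "(\<lambda>m. norm (A m (?k m) - A m (?i m) - (h m * (real (?k m) - real (?i m))) *\<^sub>R c))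
      \<longlonglongrightarrow> norm (a t - a s - (t - s) *\<^sub>R c)"
    using st by (intro tendsto_intros times pointwise) auto
  show "(\<lambda>m. e' * (h m * (real (?k m) - real (?i m)))) \<longlonglongrightarrow> e' * (t - s)"
    by (intro tendsto_intros times)
  have "\<forall>\<^sub>F m in sequentially. \<forall>u\<in>{0..t}. dist (Y m (grid_index (h m) u)) (L u) < e' - e"
    using Y_lim[of t] e by (simp add: uniform_limit_iff)
  then show "\<forall>\<^sub>F m in sequentially. norm (A m (?k m) - A m (?i m) - (h m * (real (?k m) - real (?i m))) *\<^sub>R c)
      \<le> e' * (h m * (real (?k m) - real (?i m)))"
  proof (rule eventually_mono)
    fix m assume m: "\<forall>u\<in>{0..t}. dist (Y m (grid_index (h m) u)) (L u) < e' - e"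
    show "norm (A m (?k m) - A m (?i m) - (h m * (real (?k m) - real (?i m))) *\<^sub>R c)
      \<le> e' * (h m * (real (?k m) - real (?i m)))"
    proof (rule projected_euler.A_increment_close[OF scheme])
      fix j assume "?i m \<le> j" "j < ?k m"
      then obtain u where u: "s \<le> u" "u \<le> t" "grid_index (h m) u = j"
        using grid_index_surj[OF h_pos st, of m j] by auto
      have "norm (Y m j - L u) < e' - e" using m u st by (auto simp: dist_norm)
      moreover have "norm (Y m j - c) \<le> norm (Y m j - L u) + norm (L u - c)"
        using norm_triangle_ineq[of "Y m j - L u" "L u - c"] by simp
      ultimately show "norm (Y m j - c) \<le> e'" using close[OF u(1,2)] by linarith
    qed (intro grid_index_mono h_pos st)
  qed
qed simp

lemma a_eq_integral:
  assumes "t \<ge> 0"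
  shows "a t = integral {0..t} L"
proof -
  have "(a has_vector_derivative L s) (at s within {0..t})" if s: "s \<in> {0..t}" for s
    unfolding has_vector_derivative_def has_derivative_within_alt
  proof (intro conjI allI impI)
    fix e :: real assume e: "e > 0"
    obtain d where d: "d > 0" "\<And>u. \<lbrakk>u \<ge> 0; dist u s < d\<rbrakk> \<Longrightarrow> dist (L u) (L s) < e/2"
      using L_cont s e unfolding continuous_on_iff by (metis atLeast_iff atLeastAtMost_iff half_gt_zero)
    have *: "norm (a q - a p - (q - p) *\<^sub>R L s) \<le> e * (q - p)"
      if "0 \<le> p" "p \<le> q" "\<And>u. \<lbrakk>p \<le> u; u \<le> q\<rbrakk> \<Longrightarrow> dist u s < d" for p q
    proof (rule a_increment_close[where e = "e/2"])
      fix u assume "p \<le> u" "u \<le> q"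
      then show "norm (L u - L s) \<le> e/2" using d(2)[of u] that by (auto simp: dist_norm intro: less_imp_le)
    qed (use that e in auto)
    show "\<exists>d>0. \<forall>u\<in>{0..t}. norm (u - s) < d \<longrightarrow> norm (a u - a s - (u - s) *\<^sub>R L s) \<le> e * norm (u - s)"
    proof (intro exI[of _ d] conjI ballI impI)
      fix u assume u: "u \<in> {0..t}" "norm (u - s) < d"
      show "norm (a u - a s - (u - s) *\<^sub>R L s) \<le> e * norm (u - s)"
      proof (cases "s \<le> u")
        case True
        then show ?thesis using *[of s u] s u by (auto simp: dist_real_def)
      next
        case False
        have "norm (a s - a u - (s - u) *\<^sub>R L s) \<le> e * (s - u)"
          using *[of u s] False s u by (auto simp: dist_real_def)
        moreover have "a u - a s - (u - s) *\<^sub>R L s = - (a s - a u - (s - u) *\<^sub>R L s)"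
          by (simp add: algebra_simps)
        ultimately show ?thesis using False by (simp only: norm_minus_cancel) simp
      qed
    qed (use d in auto)
  qed (rule bounded_linear_scaleR_left)
  then have "(L has_integral a t - a 0) {0..t}"
    using assms by (intro fundamental_theorem_of_calculus) auto
  moreover have "a 0 = 0"
    using pointwise(3)[of 0] projected_euler.start(2)[OF scheme] by (simp add: LIMSEQ_const_iff)
  ultimately show ?thesis by (simp add: integral_unique)
qed

text \<open>The last two properties use the geometry.  While \<open>x\<close> is inside \<open>D\<close>, it keeps a positive
  distance to the boundary on compact time intervals, so the schemes do not push there either.  If
  \<open>x r\<close> is on the boundary and the interval is short, all boundary points that the schemes meet are
  close to \<open>x r\<close> and have nearly the same normal.\<close>

sublocale reflected_path D n C\<^sub>0 x L v
proof unfold_locales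
  show "continuous_on {0..} x" "continuous_on {0..} L" "continuous_on {0..} v"
    by (fact x_cont L_cont v_cont)+
  show "x t \<in> closure D" if "t \<ge> 0" for t
    using projected_euler.X_closure[OF scheme]
    by (intro closed_sequentially[OF closed_closure _ pointwise(1)[OF that]]) auto
  show "L 0 = 0" "v 0 = 0"
    using pointwise(2,4)[of 0] projected_euler.start[OF scheme] by (simp_all add: LIMSEQ_const_iff)
next
  fix s t :: real assume st: "0 \<le> s" "s \<le> t"
  show "norm (L t - L s) \<le> v t - v s"
  proof (rule tendsto_le)
    show "(\<lambda>m. norm (Y m (grid_index (h m) t) - Y m (grid_index (h m) s))) \<longlonglongrightarrow> norm (L t - L s)"
      "(\<lambda>m. l m (grid_index (h m) t) - l m (grid_index (h m) s)) \<longlonglongrightarrow> v t - v s"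
      using st by (auto intro!: tendsto_intros pointwise)
  qed (auto intro!: always_eventually projected_euler.Y_increment_le[OF scheme] grid_index_mono h_pos st)
  assume inside: "\<And>u. \<lbrakk>s \<le> u; u \<le> t\<rbrakk> \<Longrightarrow> x u \<notin> frontier D"
  have "compact (x ` {s..t})"
    using st by (intro compact_continuous_image continuous_on_subset[OF x_cont]) auto
  moreover have "x ` {s..t} \<inter> frontier D = {}" using inside by auto
  ultimately obtain d where d: "d > 0" "\<And>y z. \<lbrakk>y \<in> x ` {s..t}; z \<in> frontier D\<rbrakk> \<Longrightarrow> d \<le> dist y z"
    using separate_compact_closed[of "x ` {s..t}" "frontier D"] by auto
  have "\<forall>\<^sub>F m in sequentially. \<forall>u\<in>{0..t}. dist (X m (grid_index (h m) u)) (x u) < d"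
    using X_lim[of t] d(1) by (simp add: uniform_limit_iff)
  then have "\<forall>\<^sub>F m in sequentially. l m (grid_index (h m) t) = l m (grid_index (h m) s)"
  proof (rule eventually_mono)
    fix m assume m: "\<forall>u\<in>{0..t}. dist (X m (grid_index (h m) u)) (x u) < d"
    show "l m (grid_index (h m) t) = l m (grid_index (h m) s)"
    proof (rule projected_euler.l_constant[OF scheme])
      fix j assume "grid_index (h m) s < j" "j \<le> grid_index (h m) t"
      then obtain u where u: "s \<le> u" "u \<le> t" "grid_index (h m) u = j"
        using grid_index_surj[OF h_pos st, of m j] by auto
      then have "dist (X m j) (x u) < d" using m st by auto
      moreover have "x u \<in> x ` {s..t}" using u by auto
      ultimately show "X m j \<notin> frontier D" using d(2) by (metis dist_commute not_less)
    qed (intro grid_index_mono h_pos st)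
  qed
  moreover have "(\<lambda>m. l m (grid_index (h m) t)) \<longlonglongrightarrow> v t" "(\<lambda>m. l m (grid_index (h m) s)) \<longlonglongrightarrow> v s"
    using st by (intro pointwise; simp)+
  ultimately show "v t = v s" by (metis LIMSEQ_unique tendsto_cong)
next
  fix T e :: real assume Te: "T \<ge> 0" "e > 0"
  obtain d0 where d0: "d0 > 0"
    "\<And>y z. \<lbrakk>y \<in> frontier D; z \<in> frontier D; norm (y - z) < d0\<rbrakk> \<Longrightarrow> norm (n y - n z) < e"
    using normal_uniformly_continuous[OF Te(2)] by blast
  have "uniformly_continuous_on {0..T} x"
    by (rule compact_uniformly_continuous[OF continuous_on_subset[OF x_cont]]) auto
  then obtain d where d: "d > 0" "\<And>s t. \<lbrakk>s \<in> {0..T}; t \<in> {0..T}; dist t s < d\<rbrakk> \<Longrightarrow> dist (x t) (x s) < d0/2"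
    unfolding uniformly_continuous_on_def using d0(1) by (metis half_gt_zero)
  have "norm (L t - L s - (v t - v s) *\<^sub>R n (x r)) \<le> e * (v t - v s)"
    if srt: "0 \<le> s" "s \<le> r" "r \<le> t" "t \<le> T" "t - s < d" "x r \<in> frontier D" for s r t
  proof (rule tendsto_le)
    let ?i = "\<lambda>m. grid_index (h m) s" and ?k = "\<lambda>m. grid_index (h m) t"
    show "(\<lambda>m. norm (Y m (?k m) - Y m (?i m) - (l m (?k m) - l m (?i m)) *\<^sub>R n (x r)))
        \<longlonglongrightarrow> norm (L t - L s - (v t - v s) *\<^sub>R n (x r))"
      "(\<lambda>m. e * (l m (?k m) - l m (?i m))) \<longlonglongrightarrow> e * (v t - v s)"
      using srt by (auto intro!: tendsto_intros pointwise)
    have st: "s \<le> t" using srt by simp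
    have "\<forall>\<^sub>F m in sequentially. \<forall>u\<in>{0..T}. dist (X m (grid_index (h m) u)) (x u) < d0/2"
      using d0(1) by (intro uniform_limitD[OF X_lim]) simp
    then show "\<forall>\<^sub>F m in sequentially. norm (Y m (?k m) - Y m (?i m) - (l m (?k m) - l m (?i m)) *\<^sub>R n (x r))
        \<le> e * (l m (?k m) - l m (?i m))"
    proof (rule eventually_mono)
      fix m assume m: "\<forall>u\<in>{0..T}. dist (X m (grid_index (h m) u)) (x u) < d0/2"
      show "norm (Y m (?k m) - Y m (?i m) - (l m (?k m) - l m (?i m)) *\<^sub>R n (x r))
        \<le> e * (l m (?k m) - l m (?i m))"
      proof (rule projected_euler.Y_increment_close[OF scheme])
        fix j assume j: "?i m < j" "j \<le> ?k m" "X m j \<in> frontier D"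
        then obtain u where u: "s \<le> u" "u \<le> t" "grid_index (h m) u = j"
          using grid_index_surj[OF h_pos srt(1) st, of m j] by auto
        have "dist (X m j) (x u) < d0/2" using m u srt by auto
        moreover have "dist (x u) (x r) < d0/2"
          using u srt by (intro d(2)) (auto simp: dist_real_def)
        ultimately have "norm (X m j - x r) < d0"
          using dist_triangle[of "X m j" "x r" "x u"] by (simp add: dist_norm)
        then show "norm (n (X m j) - n (x r)) \<le> e"
          using d0(2) j(3) srt(6) by (auto intro: less_imp_le)
      qed (intro grid_index_mono h_pos st)
    qed
  qed simp
  with d(1) show "\<exists>d>0. \<forall>s r t. 0 \<le> s \<and> s \<le> r \<and> r \<le> t \<and> t \<le> T \<and> t - s < d \<and>
      x r \<in> frontier D \<longrightarrow> norm (L t - L s - (v t - v s) *\<^sub>R n (x r)) \<le> e * (v t - v s)"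
    by blast
qed

lemma limit_solves_extended_skorohod: "extended_skorohod_solution w D n x L"
  by (rule solves_extended_skorohod) (simp add: x_def a_eq_integral)

end

theorem (in reflecting_domain) extended_skorohod_exists:
  assumes w: "continuous_on {0..} w" and w0: "w 0 \<in> D"
  shows "\<exists>x L. extended_skorohod_solution w D n x L"
proof -
  define h where "h m = 1 / (real m + 1)" for m :: nat
  have h: "0 < h m" "h m \<le> 1" for m by (auto simp: h_def)
  have h_lim: "h \<longlonglongrightarrow> 0"
    unfolding h_def using LIMSEQ_inverse_real_of_nat by (simp add: inverse_eq_divide add.commute)
  have "\<forall>m. \<exists>X Y A l. projected_euler D n C\<^sub>0 w (h m) X Y A l"
    using projected_euler_exists[of w, OF w0 h] by blast
  then obtain X Y A l where scheme: "projected_euler D n C\<^sub>0 w (h m) (X m) (Y m) (A m) (l m)" for m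
    by metis
  define F where "F m t = (Y m (grid_index (h m) t), A m (grid_index (h m) t), l m (grid_index (h m) t))"
    for m t
  have F0: "F m 0 = 0" for m
    by (simp add: F_def projected_euler.start[OF scheme] zero_prod_def)
  have equi: "\<exists>d>0. \<exists>M. \<forall>m\<ge>M. \<forall>s t. 0 \<le> s \<and> s \<le> t \<and> t \<le> T \<and> t - s < d \<longrightarrow> norm (F m t - F m s) \<le> e"
    if Te: "T \<ge> 0" "e > 0" for T e
  proof -
    obtain d where d: "d > 0" "\<And>h X Y A l i k. \<lbrakk>projected_euler D n C\<^sub>0 w h X Y A l; i \<le> k; h * real k \<le> T;
          h * (real k - real i) \<le> d\<rbrakk> \<Longrightarrow> l k - l i \<le> e/3 \<and> norm (A k - A i) \<le> e/3"
      using uniform_oscillation[OF w, of "e/3" T] Te by auto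
    have "\<forall>\<^sub>F m in sequentially. h m < d/2" using h_lim d(1) by (intro order_tendstoD) auto
    then obtain M where M: "\<And>m. m \<ge> M \<Longrightarrow> h m < d/2" by (auto simp: eventually_sequentially)
    have "norm (F m t - F m s) \<le> e" if m: "m \<ge> M" and st: "0 \<le> s" "s \<le> t" "t \<le> T" "t - s < d/2" for m s t
    proof -
      define i k where "i = grid_index (h m) s" and "k = grid_index (h m) t"
      have ik: "i \<le> k" using st h by (auto simp: i_def k_def intro: grid_index_mono)
      have i: "s < h m * i + h m" using grid_index_bounds[OF h(1)] st by (simp add: i_def)
      have k: "h m * k \<le> t" using grid_index_bounds[OF h(1)] st by (simp add: k_def)
      have *: "l m k - l m i \<le> e/3 \<and> norm (A m k - A m i) \<le> e/3"
      proof (rule d(2)[OF scheme ik])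
        show "h m * k \<le> T" using k st by linarith
        show "h m * (real k - real i) \<le> d"
          using i k st M[OF m] unfolding right_diff_distrib by linarith
      qed
      have "norm (F m t - F m s) \<le> norm (Y m k - Y m i) + norm (A m k - A m i, l m k - l m i)"
        unfolding F_def i_def[symmetric] k_def[symmetric] diff_Pair by (rule norm_Pair_le)
      also have "\<dots> \<le> norm (Y m k - Y m i) + (norm (A m k - A m i) + norm (l m k - l m i))"
        by (intro add_left_mono norm_Pair_le)
      also have "norm (l m k - l m i) = l m k - l m i"
        using projected_euler.l_mono[OF scheme ik] by simp
      finally show ?thesis using * projected_euler.Y_increment_le[OF scheme ik, of m] by linarith
    qed
    then show ?thesis using d(1) by (intro exI[of _ "d/2"]) auto
  qed
  obtain r f where r: "strict_mono r" and f: "continuous_on {0..} f"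
    and lim: "\<And>T. uniform_limit {0..T} (\<lambda>m. F (r m)) f sequentially"
    using asymptotic_Arzela_Ascoli[of F, OF F0 equi] by blast
  define L a v where "L t = fst (f t)" and "a t = fst (snd (f t))" and "v t = snd (snd (f t))" for t
  note lim_snd = bounded_linear.uniform_limit[OF bounded_linear_snd lim]
  have "euler_limit D n C\<^sub>0 w (h \<circ> r) (X \<circ> r) (Y \<circ> r) (A \<circ> r) (l \<circ> r) L a v"
  proof (intro euler_limit.intro euler_limit_axioms.intro)
    show "reflecting_domain D n C\<^sub>0" by (rule reflecting_domain_axioms)
    show "projected_euler D n C\<^sub>0 w ((h \<circ> r) m) ((X \<circ> r) m) ((Y \<circ> r) m) ((A \<circ> r) m) ((l \<circ> r) m)" for m
      using scheme by simp
    show "(h \<circ> r) \<longlonglongrightarrow> 0" using h_lim r by (rule LIMSEQ_subseq_LIMSEQ)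
    show "continuous_on {0..} L" "continuous_on {0..} a" "continuous_on {0..} v"
      unfolding L_def a_def v_def using f by (auto intro!: continuous_intros)
    show "uniform_limit {0..T} (\<lambda>m t. (Y \<circ> r) m (grid_index ((h \<circ> r) m) t)) L sequentially" for T
      using bounded_linear.uniform_limit[OF bounded_linear_fst lim[of T]] by (simp add: F_def L_def[abs_def])
    show "uniform_limit {0..T} (\<lambda>m t. (A \<circ> r) m (grid_index ((h \<circ> r) m) t)) a sequentially" for T
      using bounded_linear.uniform_limit[OF bounded_linear_fst lim_snd[of T]] by (simp add: F_def a_def[abs_def])
    show "uniform_limit {0..T} (\<lambda>m t. (l \<circ> r) m (grid_index ((h \<circ> r) m) t)) v sequentially" for T
      using bounded_linear.uniform_limit[OF bounded_linear_snd lim_snd[of T]] by (simp add: F_def v_def[abs_def])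
  qed (rule w)
  then show ?thesis using euler_limit.limit_solves_extended_skorohod by blast
qed

section \<open>The normal field of a smooth domain\<close>

text \<open>The height above a graph grows at unit speed in the direction \<open>e\<close>, so its gradient is not zero and
  \<open>sgn\<close> normalises it.\<close>

lemma norm_inward_unit_normal:
  assumes "inward_unit_normal D p v"
  shows "norm v = 1"
proof -
  obtain r e \<gamma> g where chart: "boundary_chart 1 D p r e \<gamma>"
    and g: "GDERIV (height_above e \<gamma>) p :> g" and v: "v = sgn g"
    using assms unfolding inward_unit_normal_def by blast
  have e: "norm e = 1" using chart by (simp add: boundary_chart_def)
  have "height_above e \<gamma> (p + s *\<^sub>R e) = height_above e \<gamma> p + s" for s
    using e by (simp add: height_above_def inner_add_left scaleR_add_left norm_eq_1)
  then have "((\<lambda>s. height_above e \<gamma> (p + s *\<^sub>R e)) has_derivative (\<lambda>s. s)) (at 0)"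
    by (auto intro!: derivative_eq_intros)
  moreover have "((\<lambda>s. p + s *\<^sub>R e) has_derivative (\<lambda>s. s *\<^sub>R e)) (at 0)"
    by (auto intro!: derivative_eq_intros)
  then have "((\<lambda>s. height_above e \<gamma> (p + s *\<^sub>R e)) has_derivative (\<lambda>s. (s *\<^sub>R e) \<bullet> g)) (at 0)"
    by (rule has_derivative_compose) (use g in \<open>simp add: gderiv_def\<close>)
  ultimately have "(\<lambda>s::real. s) = (\<lambda>s. (s *\<^sub>R e) \<bullet> g)" by (rule has_derivative_unique)
  from fun_cong[OF this, of 1] have "g \<noteq> 0" by auto
  then show ?thesis by (simp add: v norm_sgn)
qed

text \<open>Boundedness of \<open>n\<close> ensures that the suprema are taken over bounded sets and therefore dominate
  their elements; \<open>Sup\<close> of an unbounded set of reals carries no information.\<close>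

lemma continuous_on_of_local_sup_bound:
  fixes n :: "'a::real_normed_vector \<Rightarrow> 'b::real_normed_vector"
  assumes bounded: "bounded (n ` S)"
    and local: "\<forall>p\<in>S. \<exists>U \<epsilon>. open U \<and> p \<in> U \<and> \<epsilon> > 0 \<and>
      (\<forall>r>0. sup0 {norm (n x - n y) | x y. x \<in> S \<inter> U \<and> y \<in> S \<inter> U \<and> norm (x - y) = r} < r / \<epsilon>)"
  shows "continuous_on S n"
  unfolding continuous_on_iff
proof (intro ballI allI impI)
  fix p e assume p: "p \<in> S" and e: "(e::real) > 0"
  obtain B where B: "\<And>x. x \<in> S \<Longrightarrow> norm (n x) \<le> B" using bounded by (auto simp: bounded_iff)
  obtain U \<epsilon> where U: "open U" "p \<in> U" "\<epsilon> > 0" and sup: "\<And>r. r > 0 \<Longrightarrow>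
      sup0 {norm (n x - n y) | x y. x \<in> S \<inter> U \<and> y \<in> S \<inter> U \<and> norm (x - y) = r} < r / \<epsilon>"
    using local p by blast
  obtain d where d: "d > 0" "ball p d \<subseteq> U" using U by (meson open_contains_ball)
  show "\<exists>d>0. \<forall>x\<in>S. dist x p < d \<longrightarrow> dist (n x) (n p) < e"
  proof (intro exI[of _ "min d (e * \<epsilon>)"] conjI ballI impI)
    fix x assume x: "x \<in> S" "dist x p < min d (e * \<epsilon>)"
    show "dist (n x) (n p) < e"
    proof (cases "x = p")
      case False
      define r where "r = norm (x - p)"
      have r: "r > 0" using False by (simp add: r_def)
      define Q where "Q = {norm (n x - n y) | x y. x \<in> S \<inter> U \<and> y \<in> S \<inter> U \<and> norm (x - y) = r}"
      have "x \<in> U" using x d by (auto simp: dist_commute subset_iff)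
      then have mem: "norm (n x - n p) \<in> Q" unfolding Q_def r_def using x p U by blast
      have "bdd_above Q"
      proof (rule bdd_aboveI)
        fix q assume "q \<in> Q"
        then obtain y z where "q = norm (n y - n z)" "y \<in> S" "z \<in> S" by (auto simp: Q_def)
        then show "q \<le> B + B" using B norm_triangle_ineq4[of "n y" "n z"] by (smt (verit))
      qed
      then have "norm (n x - n p) \<le> sup0 Q" using mem by (auto simp: sup0_def intro: cSup_upper)
      also have "\<dots> < r / \<epsilon>" using sup[OF r] by (simp add: Q_def)
      also have "\<dots> \<le> e" using x U by (simp add: r_def dist_norm field_simps)
      finally show ?thesis by (simp add: dist_norm)
    qed (use e in auto)
  qed (use d e U in auto)
qed

theorem theorem5p6:
  fixes D :: "(real ^ 'd) set" and n :: "real ^ 'd \<Rightarrow> real ^ 'd"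
  assumes dim: "CARD('d) \<ge> 2"
    and domain: "Ck_domain 1 D" "bounded D"
    and normal: "inward_unit_normal_field D n"
    and adm: "admissible D n"
    and normal_local: "\<forall>p\<in>frontier D. \<exists>U \<epsilon>. open U \<and> p \<in> U \<and> \<epsilon> > 0 \<and>
      (\<forall>r>0. sup0 {norm (n x - n y) | x y. x \<in> frontier D \<inter> U \<and> y \<in> frontier D \<inter> U \<and>
                 norm (x - y) = r} < r / \<epsilon>)"
  shows "\<forall>w :: real \<Rightarrow> real ^ 'd. continuous_on {0..} w \<longrightarrow> w 0 \<in> D \<longrightarrow>
    (\<exists>x L. extended_skorohod_solution w D n x L)"
proof -
  have unit: "norm (n p) = 1" if "p \<in> frontier D" for p
    using normal that norm_inward_unit_normal by (auto simp: inward_unit_normal_field_def)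
  have ext: "exterior_ball_condition D n" "normal_cone_condition D n"
    using adm unfolding admissible_def by blast+
  then obtain C where C: "\<And>x y. \<lbrakk>x \<in> frontier D; y \<in> closure D\<rbrakk> \<Longrightarrow> (y - x) \<bullet> n x + C * (norm (x - y))\<^sup>2 \<ge> 0"
    unfolding exterior_ball_condition_def by blast
  have "reflecting_domain D n (max C 0)"
  proof
    show "open D" using domain by (simp add: Ck_domain_def Ck_open_set_def)
    have "bounded (n ` frontier D)" using unit by (auto simp: bounded_iff intro!: exI[of _ 1])
    then show "continuous_on (frontier D) n"
      using normal_local by (rule continuous_on_of_local_sup_bound)
    show "(y - x) \<bullet> n x + max C 0 * (norm (x - y))\<^sup>2 \<ge> 0" if "x \<in> frontier D" "y \<in> closure D" for x y
    proof -
      have "C * (norm (x - y))\<^sup>2 \<le> max C 0 * (norm (x - y))\<^sup>2" by (intro mult_right_mono) auto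
      with C[OF that] show ?thesis by linarith
    qed
  qed (use domain unit ext in auto)
  then show ?thesis using reflecting_domain.extended_skorohod_exists by blast
qed

end
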